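(* Let $N\ge 2$, let $T$ be a simplex mapping associated with $C_+^N$, and let $\mathbf Z_1,\dots,\mathbf Z_n$ be a random sample (iid vectors) from a multivariate regularly varying distribution concentrated on $\mathbb R_+^N$, with angular measure $\mathbb S$ and $\mathbb S_T=\mathbb S\circ T^{-1}$. Put $\mathbf U_i=T(\mathbf Z_i/\|\mathbf Z_i\|)$ and let $K=\operatorname{supp}(\mathbb S_T)$. Assume: (i) for every $m\ge 2$ and every $\mathbf x\in G_m$, $K\cap \mathrm{cl}(M(\mathbf x,m))\ne\emptyset$ implies $K\cap \mathrm{int}(M(\mathbf x,m))\neq\emptyset$; (ii) the points $\mathbf U^{(k)}_1,\dots,\mathbf U^{(k)}_k$ of the empirical angular measure $\hat{\mathbb S}_{n,T}=\frac1k\sum_{i=1}^k\epsilon_{\mathbf U_i^{(k)}}$ satisfy, for all $\eta>0$, $$k\,\mathbb P\big(d(\mathbf U^{(k)}_1,K)>\eta\big)\to 0,\qquad k\to\infty .$$ Then, as $n\to\infty$, with $k=k(n)\to\infty$, $k/n\to 0$ and $m=m(n)\to\infty$, $$\mathrm{Rast}\big(\operatorname{supp}(\hat{\mathbb S}_{n,T}),m(n)\big)=\widehat{\mathbf{Tsupp}}(k(n),m(n))\Rightarrow \operatorname{supp}(\mathbb S_T)$$ in the space of compact subsets of $[0,1]^{N-1}$ metrized by the Hausdorff metric $D$. Equivalently, $D\big(\widehat{\mathbf{Tsupp}}(k(n),m(n)),\operatorname{supp}(\mathbb S_T)\big)\to 0$ in probability; or, synonymously, for any $\delta>0$, $$\mathbb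 P\big(\widehat{\mathbf{Tsupp}}(k(n),m(n))\subset(\operatorname{supp}(\mathbb S_T))^\delta\big)\to 1\quad\text{and}\quad \mathbb P\big(\operatorname{supp}(\mathbb S_T)\subset \widehat{\mathbf{Tsupp}}(k(n),m(n))^\delta\big)\to 1,\qquad n\to\infty.$$
   Context: Notation. $\|\mathbf x\|=\sum_i|x^{(i)}|$ is the $L_1$-norm, $d$ is Euclidean distance, $C^N=\{\mathbf z\in\mathbb R^N:\|\mathbf z\|=1\}$, $C_+^N=C^N\cap\mathbb R_+^N$. For a set $A$, $A^\delta=\{x:d(x,A)<\delta\}$. $\epsilon_x$ is the unit point mass at $x$. $\Rightarrow$ is weak convergence (convergence in distribution). $\operatorname{supp}$ is the (closed) support of a measure. Multivariate regular variation. A random vector $\mathbf Z$ in $\mathbb R^N$ is (standard) multivariate regularly varying if there is a function $b(t)\uparrow\infty$ and a Radon measure $\nu$ on $\mathbb E=[-\infty,\infty]^N\setminus\{\mathbf 0\}$ with $t\,\mathbb P(\mathbf Z/b(t)\in\cdot)\to\nu$ vaguely in $M_+(\mathbb E)$ (the non-negative Radon measures on $\mathbb E$); equivalently, $t\,\mathbb P\big((\|\mathbf Z\|/b(t),\mathbf Z/\|\mathbf Z\|)\in\cdot\big)\to c\,\nu_\alpha\times\mathbb S$ vaguely in $M_+((0,\infty]\times C^N)$, where $c>0$, $\alpha>0$, $\nu_\alpha((x,\infty])=x^{-\alpha}$ and $\mathbb S$ is a probability measure on $C^N$, called the angular measure. Simplex mapping. A map $T:C_+^N\to[0,1]^{N-1}$,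 bijective onto its image, such that for some constant $a>0$, $d(\mathbf x,\mathbf y)=a\,d(T(\mathbf x),T(\mathbf y))$ for all $\mathbf x,\mathbf y\in C_+^N$. Grid. For $m\ge2$, $G_m=\{0,\frac1m,\dots,\frac{m-1}m\}^{N-1}$, and for $\mathbf x\in G_m$ the cell is $M(\mathbf x,m)=\mathbf x+[0,1/m)^{N-1}$. For compact $K$, $\mathrm{Rast}(K,m)=\mathrm{cl}\big(\bigcup\{M(\mathbf x,m):\mathbf x\in G_m,\ M(\mathbf x,m)\cap K\ne\emptyset\}\big)$. Empirical angular measure. $\|\mathbf Z_{(k+1)}\|$ is the $(k+1)$-th largest of $\|\mathbf Z_1\|,\dots,\|\mathbf Z_n\|$, and $$\hat{\mathbb S}_{n,T}=\frac1k\sum_{i=1}^n\mathbf 1(\|\mathbf Z_i\|>\|\mathbf Z_{(k+1)}\|)\,\epsilon_{\mathbf U_i}.$$ Conditionally on $\|\mathbf Z_{(k+1)}\|$, the points of $\hat{\mathbb S}_{n,T}$ are $k$ iid random elements with common distribution $\mathbb P(\mathbf U_1\in\cdot\mid\|\mathbf Z_1\|>r)$ evaluated at $r=\|\mathbf Z_{(k+1)}\|$; they are denoted $\mathbf U_1^{(k)},\dots,\mathbf U_k^{(k)}$, so $\hat{\mathbb S}_{n,T}=\frac1k\sum_{i=1}^k\epsilon_{\mathbf U_i^{(k)}}$. Support estimator. $\widehat{\mathbf{Tsupp}}(k,m)$ is the closure of $\bigcup\{M(\mathbf x,m):\mathbf x\in G_m,\ \hat{\mathbb S}_{n,T}(M(\mathbf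 x,m))>0\}$. *)

theory Defs
  imports "HOL-Probability.Probability"
begin

section \<open>The simplex and simplex mappings\<close>

definition l1norm :: "real ^ 'n \<Rightarrow> real" where
  "l1norm x = (\<Sum>i\<in>UNIV. \<bar>x $ i\<bar>)"

definition nonneg_orthant :: "(real ^ 'n) set" where
  "nonneg_orthant = {x. \<forall>i. 0 \<le> x $ i}"

definition l1sphere :: "(real ^ 'n) set" where
  "l1sphere = {x. l1norm x = 1}"

definition l1simplex :: "(real ^ 'n) set" where
  "l1simplex = l1sphere \<inter> nonneg_orthant"

definition unit_cube :: "(real ^ 'd) set" where
  "unit_cube = {x. \<forall>i. 0 \<le> x $ i \<and> x $ i \<le> 1}"

text \<open>The relation between the dimensions of domain and codomain is not part of this definition;
  it is a constraint on the index types.\<close>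

definition simplex_mapping :: "(real ^ 'n \<Rightarrow> real ^ 'd) \<Rightarrow> bool" where
  "simplex_mapping T \<longleftrightarrow> T ` l1simplex \<subseteq> unit_cube \<and> inj_on T l1simplex \<and>
     (\<exists>a>0. \<forall>x\<in>l1simplex. \<forall>y\<in>l1simplex. dist x y = a * dist (T x) (T y))"

text \<open>A simplex mapping lives on the simplex only. In HOL it is a total function whose values
  elsewhere are arbitrary, possibly not even measurable, so they are masked. The value \<open>0\<close> is
  irrelevant below: it is only used on null sets and for sample points with norm \<open>0\<close>, which never
  count as exceedances.\<close>

definition on_simplex :: "(real ^ 'n \<Rightarrow> real ^ 'd) \<Rightarrow> real ^ 'n \<Rightarrow> real ^ 'd" where
  "on_simplex T x = (if x \<in> l1simplex then T x else 0)"

definition mapped_angle :: "(real ^ 'n \<Rightarrow> real ^ 'd) \<Rightarrow> real ^ 'n \<Rightarrow> real ^ 'd" where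
  "mapped_angle T z = on_simplex T (z /\<^sub>R l1norm z)"


section \<open>Multivariate regular variation\<close>

text \<open>Vague convergence, as \<open>t \<rightarrow> \<infinity>\<close>, of Radon measures on the subspace \<open>X\<close> of the ambient space:
  convergence of integrals of nonnegative continuous functions on \<open>X\<close> with compact support in \<open>X\<close>.
  The measures are given on the ambient space; mass outside \<open>X\<close> is ignored.\<close>

definition vague_tendsto_on ::
    "'a::topological_space set \<Rightarrow> (real \<Rightarrow> 'a measure) \<Rightarrow> 'a measure \<Rightarrow> bool" where
  "vague_tendsto_on X \<mu> \<nu> \<longleftrightarrow>
     (\<forall>f :: 'a \<Rightarrow> real. continuous_on X f \<and> (\<forall>x\<in>X. 0 \<le> f x) \<and>
          (\<exists>K. compact K \<and> K \<subseteq> X \<and> (\<forall>x\<in>X - K. f x = 0)) \<longrightarrow>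
        ((\<lambda>t. set_lebesgue_integral (\<mu> t) X f) \<longlongrightarrow> set_lebesgue_integral \<nu> X f) at_top)"

text \<open>The measure on \<open>(0,\<infinity>]\<close> with tail function \<open>x powr -\<alpha>\<close>; it does not charge \<open>\<infinity>\<close>.\<close>

definition nu_alpha :: "real \<Rightarrow> ereal measure" where
  "nu_alpha \<alpha> =
     distr (density lborel (\<lambda>x. ennreal (\<alpha> * x powr (- \<alpha> - 1)) * indicator {0<..} x)) borel ereal"

lemma emeasure_nu_alpha:
  assumes "\<alpha> > 0" "x > 0"
  shows "emeasure (nu_alpha \<alpha>) {ereal x<..} = ennreal (x powr (- \<alpha>))"
proof -
  have pre: "ereal -` {ereal x<..} = {x<..}" by auto
  have "emeasure (nu_alpha \<alpha>) {ereal x<..} =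
      emeasure (density lborel (\<lambda>x. ennreal (\<alpha> * x powr (- \<alpha> - 1)) * indicator {0<..} x)) {x<..}"
    unfolding nu_alpha_def by (subst emeasure_distr) (auto simp: pre)
  also have "\<dots> = (\<integral>\<^sup>+y. ennreal (\<alpha> * y powr (- \<alpha> - 1)) * indicator {0<..} y * indicator {x<..} y \<partial>lborel)"
    by (subst emeasure_density) auto
  also have "\<dots> = (\<integral>\<^sup>+y. ennreal (\<alpha> * y powr (- \<alpha> - 1)) * indicator {x..} y \<partial>lborel)"
    using AE_lborel_singleton[of x] assms
    by (intro nn_integral_cong_AE) (auto simp: indicator_def)
  also have "\<dots> = ennreal (0 - (- (x powr (- \<alpha>))))"
  proof (rule nn_integral_FTC_atLeast)
    show "((\<lambda>y. - (y powr (- \<alpha>))) has_real_derivative \<alpha> * y powr (- \<alpha> - 1)) (at y)" if "x \<le> y" for y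
      using that assms by (auto intro!: derivative_eq_intros)
    have "((\<lambda>y. y powr (- \<alpha>)) \<longlongrightarrow> 0) at_top"
      using assms by (intro tendsto_neg_powr filterlim_ident) auto
    from tendsto_minus[OF this] show "((\<lambda>y. - (y powr (- \<alpha>))) \<longlongrightarrow> 0) at_top" by simp
  qed (use assms in auto)
  finally show ?thesis by simp
qed

text \<open>\<open>Z\<close> is regularly varying with angular measure \<open>S\<close>: the polar form of (standard) multivariate
  regular variation. The radial component lives in \<open>(0,\<infinity>]\<close>, so that compact sets may contain
  neighbourhoods of \<open>\<infinity>\<close>. The event \<open>Z = 0\<close> is mapped outside \<open>(0,\<infinity>] \<times> l1sphere\<close>.\<close>

definition mrv_angular ::
    "'w measure \<Rightarrow> ('w \<Rightarrow> real ^ 'n) \<Rightarrow> (real ^ 'n) measure \<Rightarrow> bool" where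
  "mrv_angular M Z S \<longleftrightarrow>
     prob_space S \<and> sets S = sets borel \<and> (AE x in S. x \<in> l1sphere) \<and>
     (\<exists>b c \<alpha>. mono_on {0<..} b \<and> filterlim b at_top at_top \<and> 0 < c \<and> 0 < \<alpha> \<and>
        vague_tendsto_on ({0<..} \<times> l1sphere)
          (\<lambda>t. scale_measure (ennreal t)
             (distr M borel (\<lambda>\<omega>. (ereal (l1norm (Z \<omega>) / b t), Z \<omega> /\<^sub>R l1norm (Z \<omega>)))))
          (scale_measure (ennreal c) (nu_alpha \<alpha> \<Otimes>\<^sub>M S)))"

definition angular_image :: "(real ^ 'n \<Rightarrow> real ^ 'd) \<Rightarrow> (real ^ 'n) measure \<Rightarrow> (real ^ 'd) measure" where
  "angular_image T S = distr S borel (on_simplex T)"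

definition msupp :: "'a::topological_space measure \<Rightarrow> 'a set" where
  "msupp \<mu> = {x. \<forall>V. open V \<and> x \<in> V \<longrightarrow> 0 < emeasure \<mu> V}"


section \<open>Grid, cells and rasterization\<close>

definition grid :: "nat \<Rightarrow> (real ^ 'd) set" where
  "grid m = {x. \<forall>i. \<exists>j<m. x $ i = real j / real m}"

definition cell :: "real ^ 'd \<Rightarrow> nat \<Rightarrow> (real ^ 'd) set" where
  "cell x m = {y. \<forall>i. x $ i \<le> y $ i \<and> y $ i < x $ i + 1 / real m}"

definition rast :: "(real ^ 'd) set \<Rightarrow> nat \<Rightarrow> (real ^ 'd) set" where
  "rast K m = closure (\<Union>{cell x m | x. x \<in> grid m \<and> cell x m \<inter> K \<noteq> {}})"


section \<open>Empirical angular measure and support estimator\<close>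

text \<open>A sample of size \<open>n\<close> is given by \<open>z 0, \<dots>, z (n - 1)\<close>. The index \<open>k\<close> counts from \<open>0\<close>, so
  \<open>norm_order_stat z n k\<close> is the \<open>(k+1)\<close>-th largest norm; it is meaningful for \<open>k < n\<close>.\<close>

definition norm_order_stat :: "(nat \<Rightarrow> real ^ 'n) \<Rightarrow> nat \<Rightarrow> nat \<Rightarrow> real" where
  "norm_order_stat z n k = rev (sort (map (\<lambda>i. l1norm (z i)) [0..<n])) ! k"

definition exceedances :: "(nat \<Rightarrow> real ^ 'n) \<Rightarrow> nat \<Rightarrow> nat \<Rightarrow> nat set" where
  "exceedances z n k = {i. i < n \<and> norm_order_stat z n k < l1norm (z i)}"

definition emp_angular ::
    "(real ^ 'n \<Rightarrow> real ^ 'd) \<Rightarrow> (nat \<Rightarrow> real ^ 'n) \<Rightarrow> nat \<Rightarrow> nat \<Rightarrow> (real ^ 'd) measure" where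
  "emp_angular T z n k =
     scale_measure (ennreal (1 / real k))
       (distr (count_space (exceedances z n k)) borel (\<lambda>i. mapped_angle T (z i)))"

lemma emeasure_emp_angular:
  assumes "A \<in> sets borel"
  shows "emeasure (emp_angular T z n k) A =
    ennreal (1 / real k * (\<Sum>i<n. indicator {i. norm_order_stat z n k < l1norm (z i)} i
                                    * indicator A (mapped_angle T (z i))))"
proof -
  let ?E = "exceedances z n k" and ?U = "\<lambda>i. mapped_angle T (z i)"
  have fin: "finite ?E" unfolding exceedances_def by simp
  have "(\<Sum>i<n. indicator {i. norm_order_stat z n k < l1norm (z i)} i * indicator A (?U i))
      = (\<Sum>i<n. if i \<in> ?E \<and> ?U i \<in> A then 1 else (0::real))"
    by (intro sum.cong) (auto simp: exceedances_def indicator_def)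
  also have "\<dots> = real (card {i\<in>{..<n}. i \<in> ?E \<and> ?U i \<in> A})"
    by (subst sum.inter_filter[symmetric]) auto
  also have "{i\<in>{..<n}. i \<in> ?E \<and> ?U i \<in> A} = ?U -` A \<inter> ?E"
    by (auto simp: exceedances_def)
  finally have s: "(\<Sum>i<n. indicator {i. norm_order_stat z n k < l1norm (z i)} i * indicator A (?U i))
      = real (card (?U -` A \<inter> ?E))" .
  have "emeasure (distr (count_space ?E) borel ?U) A = ennreal (real (card (?U -` A \<inter> ?E)))"
    using fin assms
    by (subst emeasure_distr) (auto simp: emeasure_count_space ennreal_of_nat_eq_real_of_nat)
  then show ?thesis
    unfolding emp_angular_def s by (simp add: ennreal_mult'[symmetric] del: ennreal_of_nat_eq_real_of_nat)
qed

text \<open>The points of the empirical angular measure, listed in the order in which they occur in the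
  sample (again from \<open>j = 0\<close>); this is the labelling for which, given the order statistic, they are
  iid. They are defined for \<open>j < card (exceedances z n k)\<close>, which is \<open>j < k\<close> in the absence of ties
  in the norms.\<close>

definition emp_point ::
    "(real ^ 'n \<Rightarrow> real ^ 'd) \<Rightarrow> (nat \<Rightarrow> real ^ 'n) \<Rightarrow> nat \<Rightarrow> nat \<Rightarrow> nat \<Rightarrow> real ^ 'd" where
  "emp_point T z n k j = mapped_angle T (z (sorted_list_of_set (exceedances z n k) ! j))"

definition tsupp_hat ::
    "(real ^ 'n \<Rightarrow> real ^ 'd) \<Rightarrow> (nat \<Rightarrow> real ^ 'n) \<Rightarrow> nat \<Rightarrow> nat \<Rightarrow> nat \<Rightarrow> (real ^ 'd) set" where
  "tsupp_hat T z n k m =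
     closure (\<Union>{cell x m | x. x \<in> grid m \<and> 0 < emeasure (emp_angular T z n k) (cell x m)})"


section \<open>The Hausdorff metric and convergence in distribution of random compact sets\<close>

text \<open>\<open>{x. d(x,A) < \<delta>}\<close>, with \<open>d(x,{}) = \<infinity>\<close>. It is not defined by \<open>infdist\<close>, as
  \<open>infdist x {} = 0\<close> and the support estimator may be empty.\<close>

definition delta_nbhd :: "'a::metric_space set \<Rightarrow> real \<Rightarrow> 'a set" where
  "delta_nbhd A \<delta> = {x. \<exists>a\<in>A. dist x a < \<delta>}"

text \<open>The distance between the empty set and a nonempty set is \<open>\<infinity>\<close>.\<close>

definition hausdorff_dist :: "'a::metric_space set \<Rightarrow> 'a set \<Rightarrow> ennreal" where
  "hausdorff_dist A B =
     Inf {ennreal \<delta> | \<delta>. 0 < \<delta> \<and> A \<subseteq> delta_nbhd B \<delta> \<and> B \<subseteq> delta_nbhd A \<delta>}"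

definition cube_compacts :: "(real ^ 'd) set set" where
  "cube_compacts = {A. compact A \<and> A \<subseteq> unit_cube}"

text \<open>Weak convergence in \<open>cube_compacts\<close> with the metric \<open>hausdorff_dist\<close>, by means of bounded
  continuous test functions.\<close>

definition conv_in_distribution ::
    "'w measure \<Rightarrow> (nat \<Rightarrow> 'w \<Rightarrow> (real ^ 'd) set) \<Rightarrow> ('w \<Rightarrow> (real ^ 'd) set) \<Rightarrow> bool" where
  "conv_in_distribution M X Y \<longleftrightarrow>
     (\<forall>n. \<forall>\<omega>\<in>space M. X n \<omega> \<in> cube_compacts) \<and> (\<forall>\<omega>\<in>space M. Y \<omega> \<in> cube_compacts) \<and>
     (\<forall>F :: (real ^ 'd) set \<Rightarrow> real.
        (\<exists>c. \<forall>A\<in>cube_compacts. \<bar>F A\<bar> \<le> c) \<and>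
        (\<forall>A\<in>cube_compacts. \<forall>\<epsilon>>0. \<exists>\<delta>>0. \<forall>B\<in>cube_compacts.
            hausdorff_dist A B < ennreal \<delta> \<longrightarrow> \<bar>F B - F A\<bar> < \<epsilon>) \<longrightarrow>
        (\<lambda>n. \<integral>\<omega>. F (X n \<omega>) \<partial>M) \<longlonglongrightarrow> (\<integral>\<omega>. F (Y \<omega>) \<partial>M))"

end

theory Submission
  imports Defs
begin

text \<open>
  Outer inclusion: given the set of indices of the exceedances, the exceedances are exchangeable,
  so the probability that some \<open>U\<^sub>i\<close> is farther than \<open>\<eta>\<close> from \<open>K\<close> is at most \<open>k\<close> times the probability
  that the first one is, which tends to \<open>0\<close> by assumption. Cells have diameter \<open>O(1/m)\<close>.

  Inner inclusion: regular variation, used at \<open>t = n / k\<close>, provides a level \<open>u\<close> such that the number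
  of sample points of norm greater than \<open>u\<close> has expectation at most \<open>k / 2\<close>, hence is at most \<open>k\<close> up to an
  exponentially small probability, so that all these points are exceedances. On the other hand the
  expected number of those whose angle is in a given open set \<open>V\<close> of positive mass is at least
  \<open>q * k\<close>, so one of them exists with probability tending to \<open>1\<close>. It suffices to let \<open>V\<close> range over
  the interiors of finitely many cells of a fixed grid.
\<close>

section \<open>Exceedances\<close>

text \<open>The threshold is an order statistic of the same sample, so whether a point counts
  depends on all the others. The way out is a counting form: an index is an exceedance exactly when
  at most \<open>k\<close> sample points have norm at least its own. This form is symmetric in the
  indices, which yields exchangeability; it is tie-proof; and it compares the random threshold with
  a deterministic level merely by counting points above that level. The fraction 1/2 comes from the
  Markov bound \<open>exp (k / 2) / 2 ^ k\<close> for having too many points above the level: it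
  decays because \<open>exp (1/2) < 2\<close>, and any fraction below ln 2 would serve. In the inner
  inclusion the resolution \<open>m\<close> of the estimator may be arbitrary: a mapped angle with
  coordinates in [0,1) lies in the estimator as soon as it comes from an exceedance, so the covering
  grid can be fixed by \<delta> alone. The masked map takes the value 0 off the simplex. Open sets
  avoiding 0 keep that default from posing as an angle, and interiors of cells do avoid it. For
  fixed n the estimator has finitely many values, so with \<open>k n < n\<close> every predicate or
  functional of it is measurable.\<close>

lemma norm_order_stat_less_iff:
  assumes "k < n"
  shows "norm_order_stat z n k < v \<longleftrightarrow> card {j. j < n \<and> v \<le> l1norm (z j)} \<le> k"
proof -
  define xs where "xs = rev (sort (map (\<lambda>i. l1norm (z i)) [0..<n]))"
  have len: "length xs = n" by (simp add: xs_def)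
  have anti: "xs ! q \<le> xs ! p" if "p \<le> q" "q < n" for p q
    using that len unfolding xs_def by (intro sorted_rev_nth_mono) auto
  have "mset xs = mset (map (\<lambda>i. l1norm (z i)) [0..<n])"
    by (simp add: xs_def)
  then have "length (filter (\<lambda>x. v \<le> x) xs)
      = length (filter (\<lambda>x. v \<le> x) (map (\<lambda>i. l1norm (z i)) [0..<n]))"
    by (metis mset_filter size_mset)
  also have "\<dots> = card {j. j < n \<and> v \<le> l1norm (z j)}"
    unfolding length_filter_conv_card by (rule arg_cong[where f = card]) auto
  finally have c: "card {p. p < n \<and> v \<le> xs ! p} = card {j. j < n \<and> v \<le> l1norm (z j)}"
    by (simp add: length_filter_conv_card len)
  \<comment> \<open>The list \<open>xs\<close> decreases, so its entries that are at least
    \<open>v\<close> form an initial segment. Indices start at 0, so position \<open>k\<close> lies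
    outside the segment exactly when its length is at most \<open>k\<close>.\<close>
  show ?thesis
  proof
    assume "norm_order_stat z n k < v"
    then have lt: "xs ! k < v" by (simp add: norm_order_stat_def xs_def)
    have "{p. p < n \<and> v \<le> xs ! p} \<subseteq> {..<k}"
      using anti lt by (force simp: not_less[symmetric])
    from card_mono[OF _ this] show "card {j. j < n \<and> v \<le> l1norm (z j)} \<le> k"
      by (simp add: c)
  next
    assume le: "card {j. j < n \<and> v \<le> l1norm (z j)} \<le> k"
    show "norm_order_stat z n k < v"
    proof (rule ccontr)
      assume "\<not> norm_order_stat z n k < v"
      then have ge: "v \<le> xs ! k" by (simp add: norm_order_stat_def xs_def)
      have "{..k} \<subseteq> {p. p < n \<and> v \<le> xs ! p}"
        using anti ge assms by (auto intro: order_trans)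
      from card_mono[OF _ this] show False using le c by simp
    qed
  qed
qed

lemma exceedances_eq:
  assumes "k < n"
  shows "exceedances z n k = {i. i < n \<and> card {j. j < n \<and> l1norm (z i) \<le> l1norm (z j)} \<le> k}"
  using norm_order_stat_less_iff[OF assms] by (auto simp: exceedances_def)

lemma finite_exceedances [simp]: "finite (exceedances z n k)"
  by (simp add: exceedances_def)

lemma exceedances_subset: "exceedances z n k \<subseteq> {..<n}"
  by (auto simp: exceedances_def)

text \<open>Ties can only lower the number of exceedances. All of them have norm at least that of
  the smallest one, whose own counting condition therefore bounds their number.\<close>

lemma card_exceedances_le:
  assumes "k < n"
  shows "card (exceedances z n k) \<le> k"
proof (cases "exceedances z n k = {}")
  case False
  then obtain i where i: "i \<in> exceedances z n k"
    and min: "\<And>j. j \<in> exceedances z n k \<Longrightarrow> l1norm (z i) \<le> l1norm (z j)"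
    using arg_min_if_finite[of "exceedances z n k" "\<lambda>i. l1norm (z i)"] by (auto simp: not_less)
  have "exceedances z n k \<subseteq> {j. j < n \<and> l1norm (z i) \<le> l1norm (z j)}"
    using min exceedances_subset by fastforce
  then have "card (exceedances z n k) \<le> card {j. j < n \<and> l1norm (z i) \<le> l1norm (z j)}"
    by (intro card_mono) auto
  also have "\<dots> \<le> k" using i by (simp add: exceedances_eq[OF assms])
  finally show ?thesis .
qed simp

text \<open>The number of norms above a level does not change under relabelling, so the new
  exceedance set is a preimage under the transposition; being its own inverse, the transposition
  turns this into an image.\<close>

lemma exceedances_transpose:
  assumes "k < n" "a < n" "b < n"
  shows "exceedances (\<lambda>i. z (Transposition.transpose a b i)) n k = Transposition.transpose a b ` exceedances z n k"
proof -
  let ?\<pi> = "Transposition.transpose a b"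
  have lt: "?\<pi> i < n \<longleftrightarrow> i < n" for i
    using assms by (auto simp: Transposition.transpose_def)
  have card: "card {j. j < n \<and> v \<le> l1norm (z (?\<pi> j))} = card {j. j < n \<and> v \<le> l1norm (z j)}" for v
  proof (rule bij_betw_same_card[where f = ?\<pi>])
    show "bij_betw ?\<pi> {j. j < n \<and> v \<le> l1norm (z (?\<pi> j))} {j. j < n \<and> v \<le> l1norm (z j)}"
      by (rule bij_betw_byWitness[where f' = ?\<pi>]) (auto simp: lt)
  qed
  have "exceedances (\<lambda>i. z (?\<pi> i)) n k = {i. ?\<pi> i \<in> exceedances z n k}"
    by (auto simp: exceedances_eq[OF assms(1)] card lt)
  also have "\<dots> = ?\<pi> ` exceedances z n k"
    by (force simp: image_iff intro: bexI[where x = "?\<pi> _"])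
  finally show ?thesis .
qed

text \<open>A swap inside \<open>A\<close> maps \<open>A\<close> to itself. This is the invariance
  behind exchangeability: the event that \<open>A\<close> is the exceedance set survives the
  swap.\<close>

lemma exceedances_transpose_eq_iff:
  assumes "k < n" "A \<subseteq> {..<n}" "a \<in> A" "b \<in> A"
  shows "exceedances (\<lambda>i. z (Transposition.transpose a b i)) n k = A \<longleftrightarrow> exceedances z n k = A"
proof -
  have inv: "Transposition.transpose a b ` (Transposition.transpose a b ` B) = B" for B
    by (auto simp: image_image)
  have A: "Transposition.transpose a b ` A = A"
    using assms by (force simp: Transposition.transpose_def image_iff)
  have "a < n" "b < n" using assms by auto
  then show ?thesis
    using exceedances_transpose[OF assms(1), of a b z] inv A by metis
qed

section \<open>The support estimator\<close>

lemma cell_borel [measurable]: "cell x m \<in> sets borel"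
proof -
  have "cell x m = (\<Inter>i. {y. x $ i \<le> y $ i} \<inter> {y. y $ i < x $ i + 1 / real m})"
    by (auto simp: cell_def)
  also have "\<dots> \<in> sets borel"
    by (intro sets.countable_INT'' sets.Int borel_closed borel_open
        closed_Collect_le open_Collect_less continuous_intros countable_finite) auto
  finally show ?thesis .
qed

text \<open>The conjunct \<open>0 < k\<close> records that \<open>1 / real 0 = 0\<close>, so the
  measure is zero for \<open>k = 0\<close>.\<close>

lemma emeasure_emp_angular_pos_iff:
  assumes "A \<in> sets borel"
  shows "0 < emeasure (emp_angular T z n k) A \<longleftrightarrow>
    0 < k \<and> (\<exists>i\<in>exceedances z n k. mapped_angle T (z i) \<in> A)"
proof -
  let ?E = "exceedances z n k" and ?U = "\<lambda>i. mapped_angle T (z i)"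
  have "emeasure (distr (count_space ?E) borel ?U) A = ennreal (real (card (?U -` A \<inter> ?E)))"
    using assms
    by (subst emeasure_distr) (auto simp: emeasure_count_space ennreal_of_nat_eq_real_of_nat)
  then have "0 < emeasure (emp_angular T z n k) A \<longleftrightarrow> 0 < k \<and> 0 < card (?U -` A \<inter> ?E)"
    unfolding emp_angular_def
    by (simp add: ennreal_zero_less_mult_iff del: ennreal_of_nat_eq_real_of_nat)
  then show ?thesis by (auto simp: card_gt_0_iff)
qed

lemma msupp_emp_angular:
  "msupp (emp_angular T z n k) = (if k = 0 then {} else (\<lambda>i. mapped_angle T (z i)) ` exceedances z n k)"
    (is "_ = (if k = 0 then {} else ?U ` ?E)")
proof (cases "k = 0")
  case False
  have "x \<in> ?U ` ?E" if x: "\<And>V. open V \<Longrightarrow> x \<in> V \<Longrightarrow> \<exists>i\<in>?E. ?U i \<in> V" for x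
    \<comment> \<open>Finitely many points form a closed set; a point outside would have its
      complement as a neighbourhood without mass.\<close>
    using x[of "- (?U ` ?E)"] finite_imp_closed[of "?U ` ?E"] by (auto simp: open_Compl)
  with False show ?thesis
    by (auto simp: msupp_def emeasure_emp_angular_pos_iff)
next
  case True
  then show ?thesis by (auto simp: msupp_def emeasure_emp_angular_pos_iff)
qed

text \<open>The estimator depends on the sample only through this subset of a finite grid, which
  reduces its measurability to that of finitely many events.\<close>

definition hit_cells :: "(real ^ 'n \<Rightarrow> real ^ 'd) \<Rightarrow> (nat \<Rightarrow> real ^ 'n) \<Rightarrow> nat \<Rightarrow> nat \<Rightarrow> nat \<Rightarrow> (real ^ 'd) set"
  where "hit_cells T z n k m = {x \<in> grid m. 0 < k \<and> (\<exists>i\<in>exceedances z n k. mapped_angle T (z i) \<in> cell x m)}"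

lemma tsupp_hat_eq: "tsupp_hat T z n k m = closure (\<Union>x\<in>hit_cells T z n k m. cell x m)"
  unfolding tsupp_hat_def hit_cells_def
  by (rule arg_cong[where f = closure]) (auto simp: emeasure_emp_angular_pos_iff)

lemma rast_msupp_emp_angular: "rast (msupp (emp_angular T z n k)) m = tsupp_hat T z n k m"
  unfolding tsupp_hat_eq rast_def hit_cells_def msupp_emp_angular
  by (rule arg_cong[where f = closure]) auto

section \<open>Geometry of the grid cells\<close>

lemma finite_grid: "finite (grid m :: (real ^ 'd) set)"
proof -
  have "grid m \<subseteq> (\<lambda>f. \<chi> i. real (f i) / real m) ` (UNIV \<rightarrow>\<^sub>E {..<m} :: ('d \<Rightarrow> nat) set)"
  proof
    fix x :: "real ^ 'd" assume "x \<in> grid m"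
    then have "\<forall>i. \<exists>j. j < m \<and> x $ i = real j / real m" by (auto simp: grid_def)
    from choice[OF this] obtain f where f: "\<And>i. f i < m \<and> x $ i = real (f i) / real m"
      by blast
    then have "x = (\<chi> i. real (f i) / real m)" by (simp add: vec_eq_iff)
    with f show "x \<in> (\<lambda>f. \<chi> i. real (f i) / real m) ` (UNIV \<rightarrow>\<^sub>E {..<m})" by auto
  qed
  then show ?thesis
    by (rule finite_subset) (intro finite_imageI finite_PiE, auto)
qed

lemma finite_hit_cells [simp]: "finite (hit_cells T z n k m)"
  using finite_grid by (rule finite_subset[rotated]) (auto simp: hit_cells_def)

lemma closed_unit_cube: "closed (unit_cube :: (real ^ 'd) set)"
proof -
  have eq: "unit_cube = (\<Inter>i. {x :: real ^ 'd. 0 \<le> x $ i} \<inter> {x. x $ i \<le> 1})"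
    by (auto simp: unit_cube_def)
  show ?thesis
    unfolding eq by (intro closed_INT ballI closed_Int closed_Collect_le continuous_intros)
qed

lemma compact_unit_cube: "compact (unit_cube :: (real ^ 'd) set)"
proof -
  have "unit_cube \<subseteq> cbox 0 (1 :: real ^ 'd)"
    by (auto simp: unit_cube_def mem_box_cart)
  then show ?thesis
    using closed_unit_cube bounded_subset[OF bounded_cbox] by (auto simp: compact_eq_bounded_closed)
qed

lemma cell_subset_unit_cube:
  assumes "x \<in> grid m"
  shows "cell x m \<subseteq> {y. \<forall>i. 0 \<le> y $ i \<and> y $ i < 1}"
proof (safe)
  fix y i assume y: "y \<in> cell x m"
  from assms obtain j where j: "j < m" "x $ i = real j / real m" by (auto simp: grid_def)
  from y j show "0 \<le> y $ i" by (auto simp: cell_def intro: order_trans[of 0 "x $ i"])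
  have "real j + 1 \<le> real m" using j by linarith
  then have "x $ i + 1 / real m \<le> 1" using j by (simp add: field_simps)
  with y show "y $ i < 1" by (auto simp: cell_def dest: spec[of _ i])
qed

lemma tsupp_hat_cube_compacts: "tsupp_hat T z n k m \<in> cube_compacts"
proof -
  have "tsupp_hat T z n k m \<subseteq> unit_cube"
    unfolding tsupp_hat_eq
  proof (rule closure_minimal[OF _ closed_unit_cube])
    show "(\<Union>x\<in>hit_cells T z n k m. cell x m) \<subseteq> unit_cube"
    proof safe
      fix x y assume "x \<in> hit_cells T z n k m" "y \<in> cell x m"
      with cell_subset_unit_cube[of x m] show "y \<in> unit_cube"
        by (auto simp: hit_cells_def unit_cube_def less_imp_le)
    qed
  qed
  moreover have "compact (tsupp_hat T z n k m)"
    using calculation compact_unit_cube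
    by (metis Int_absorb1 closed_Int_compact closed_closure tsupp_hat_eq inf.commute)
  ultimately show ?thesis by (simp add: cube_compacts_def)
qed

text \<open>Each coordinate varies by at most \<open>1 / m\<close> in a cell. Bounding the Euclidean
  norm by the sum of coordinates gives a cruder constant than the square root of the dimension, but
  only the order \<open>1 / m\<close> matters.\<close>

lemma dist_closure_cell_le:
  fixes x :: "real ^ 'd"
  assumes "y \<in> closure (cell x m)" "w \<in> cell x m"
  shows "dist y w \<le> real CARD('d) / real m"
proof -
  have "cell x m \<subseteq> {y. dist y w \<le> real CARD('d) / real m}"
  proof safe
    fix v assume v: "v \<in> cell x m"
    have "dist v w \<le> (\<Sum>i\<in>UNIV. \<bar>(v - w) $ i\<bar>)"
      unfolding dist_norm by (rule norm_le_l1_cart)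
    also have "\<dots> \<le> (\<Sum>i\<in>(UNIV :: 'd set). 1 / real m)"
    proof (rule sum_mono)
      fix i :: 'd
      have "x $ i \<le> v $ i" "v $ i < x $ i + 1 / real m" "x $ i \<le> w $ i" "w $ i < x $ i + 1 / real m"
        using v assms(2) by (auto simp: cell_def)
      then show "\<bar>(v - w) $ i\<bar> \<le> 1 / real m" by simp
    qed
    also have "\<dots> = real CARD('d) / real m" by simp
    finally show "dist v w \<le> real CARD('d) / real m" .
  qed
  then have "closure (cell x m) \<subseteq> {y. dist y w \<le> real CARD('d) / real m}"
    by (rule closure_minimal) (intro closed_Collect_le continuous_intros)
  with assms(1) show ?thesis by auto
qed

lemma unit_cube_subset_closure_cells:
  assumes "0 < m" "y \<in> unit_cube"
  obtains x where "x \<in> grid m" "y \<in> closure (cell x m)"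
proof -
  \<comment> \<open>The minimum with \<open>m - 1\<close> sends a coordinate equal to 1 to the last
    cell, whose closure contains it although the half-open cell does not.\<close>
  define f where "f i = min (nat \<lfloor>real m * y $ i\<rfloor>) (m - 1)" for i
  define x where "x = (\<chi> i. real (f i) / real m)"
  have x: "x \<in> grid m" using assms by (auto simp: grid_def x_def f_def intro!: exI[of _ "f _"])
  have yi: "0 \<le> y $ i" "y $ i \<le> 1" for i using assms by (auto simp: unit_cube_def)
  have le: "x $ i \<le> y $ i" "y $ i \<le> x $ i + 1 / real m" for i
  proof -
    have "real (nat \<lfloor>real m * y $ i\<rfloor>) \<le> real m * y $ i"
      using yi[of i] by simp
    moreover have "real (f i) \<le> real (nat \<lfloor>real m * y $ i\<rfloor>)" by (simp add: f_def)
    ultimately have "real (f i) \<le> real m * y $ i" by linarith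
    then show "x $ i \<le> y $ i" using assms(1) by (simp add: x_def field_simps)
    have "real m * y $ i \<le> real m" using yi[of i] by (simp add: mult_left_le)
    then have "real m * y $ i \<le> real (f i) + 1"
      using yi[of i] assms(1) by (auto simp: f_def min_def)
    then show "y $ i \<le> x $ i + 1 / real m" using assms(1) by (simp add: x_def field_simps)
  qed
  \<comment> \<open>Moving from \<open>y\<close> towards the lower corner \<open>x\<close> enters
    the half-open cell at once, even from an excluded face; the points of this segment exhibit
    \<open>y\<close> as a limit.\<close>
  have seg: "y + t *\<^sub>R (x - y) \<in> cell x m" if t: "0 < t" "t \<le> 1" for t
    unfolding cell_def
  proof safe
    fix i
    have "t * (y $ i - x $ i) \<le> 1 * (y $ i - x $ i)"
      using le[of i] t by (intro mult_right_mono) auto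
    then show "x $ i \<le> (y + t *\<^sub>R (x - y)) $ i" by (simp add: algebra_simps)
    have "y $ i - x $ i - t * (y $ i - x $ i) < 1 / real m"
    proof (cases "x $ i = y $ i")
      case False
      then have "0 < t * (y $ i - x $ i)" using le[of i] t by simp
      then show ?thesis using le[of i] by linarith
    qed (use assms in simp)
    then show "(y + t *\<^sub>R (x - y)) $ i < x $ i + 1 / real m" by (simp add: algebra_simps)
  qed
  have "(\<lambda>n. y + inverse (real (Suc n)) *\<^sub>R (x - y)) \<longlonglongrightarrow> y + 0 *\<^sub>R (x - y)"
    by (intro tendsto_intros LIMSEQ_inverse_real_of_nat)
  then have "y \<in> closure (cell x m)"
    unfolding closure_sequential
    by (intro exI[of _ "\<lambda>n. y + inverse (real (Suc n)) *\<^sub>R (x - y)"])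
       (use seg in \<open>auto simp: field_simps\<close>)
  with x show ?thesis by (rule that)
qed

lemma half_open_cube_subset_cells:
  assumes "0 < m" "\<And>i. 0 \<le> y $ i \<and> y $ i < 1"
  obtains x where "x \<in> grid m" "y \<in> cell x m"
proof -
  define f where "f i = nat \<lfloor>real m * y $ i\<rfloor>" for i
  define x where "x = (\<chi> i. real (f i) / real m)"
  have b: "real (f i) \<le> real m * y $ i" "real m * y $ i < real (f i) + 1" "f i < m" for i
  proof -
    have 0: "0 \<le> real m * y $ i" using assms by simp
    then show 1: "real (f i) \<le> real m * y $ i" "real m * y $ i < real (f i) + 1"
      by (auto simp: f_def)
    have "real m * y $ i < real m * 1" using assms by (intro mult_strict_left_mono) auto
    with 1 show "f i < m" by linarith
  qed
  show ?thesis
  proof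
    show "x \<in> grid m" using b by (auto simp: grid_def x_def)
    show "y \<in> cell x m" using b assms(1) by (auto simp: cell_def x_def field_simps)
  qed
qed

text \<open>The origin is on the boundary of the cube: a small step in a negative coordinate
  direction leaves every cell. Hence these interiors qualify as open sets free of the default value
  0.\<close>

lemma zero_notin_interior_cell:
  assumes "x \<in> grid m"
  shows "(0 :: real ^ 'd) \<notin> interior (cell x m)"
proof
  assume "0 \<in> interior (cell x m)"
  then obtain e where e: "e > 0" "ball 0 e \<subseteq> cell x m" by (auto simp: mem_interior)
  obtain i :: 'd where True by auto
  define v :: "real ^ 'd" where "v = (- (e / 2)) *\<^sub>R axis i 1"
  have "norm v = e / 2" using e by (simp add: v_def norm_axis_1)
  then have "v \<in> cell x m" using e by (auto intro!: subsetD[OF e(2)])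
  then have "0 \<le> v $ i" using cell_subset_unit_cube[OF assms] by auto
  with e show False by (simp add: v_def axis_def)
qed

section \<open>Supports\<close>

lemma closed_msupp: "closed (msupp \<mu>)"
proof -
  have "- msupp \<mu> = \<Union>{V. open V \<and> emeasure \<mu> V = 0}"
    by (auto simp: msupp_def)
  then have "open (- msupp \<mu>)" by auto
  then show ?thesis by (simp add: closed_def)
qed

lemma msupp_subset_closed:
  assumes "closed C" "emeasure \<mu> (- C) = 0"
  shows "msupp \<mu> \<subseteq> C"
  using assms by (auto simp: msupp_def closed_def)

text \<open>If every point had a null open neighbourhood, compactness would cover \<open>C\<close>
  by finitely many of them and make \<open>C\<close> null.\<close>

lemma msupp_nonempty:
  fixes \<mu> :: "'a::t2_space measure"
  assumes "sets \<mu> = sets borel" "compact C" "emeasure \<mu> C \<noteq> 0"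
  shows "msupp \<mu> \<noteq> {}"
proof
  assume "msupp \<mu> = {}"
  then have "\<forall>x. \<exists>V. open V \<and> x \<in> V \<and> emeasure \<mu> V = 0" by (auto simp: msupp_def)
  then have "C \<subseteq> \<Union>{V. open V \<and> emeasure \<mu> V = 0}" by blast
  then obtain F where F: "F \<subseteq> {V. open V \<and> emeasure \<mu> V = 0}" "finite F" "C \<subseteq> \<Union>F"
    using assms(2) by (auto elim: compactE)
  then have "V \<in> null_sets \<mu>" if "V \<in> F" for V
    using that assms(1) by (auto intro!: null_setsI)
  then have "\<Union>F \<in> null_sets \<mu>"
    using null_sets_UN'[of F "\<lambda>x. x" \<mu>] F(2) by (simp add: countable_finite)
  then have "C \<in> null_sets \<mu>"
    using F(3) assms by (intro null_sets_subset[of "\<Union>F" \<mu> C]) (auto intro: borel_compact)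
  with assms(3) show False by auto
qed

section \<open>Exceedance levels under regular variation\<close>

lemma continuous_on_l1norm [continuous_intros]:
  "continuous_on A f \<Longrightarrow> continuous_on A (\<lambda>x. l1norm (f x))"
  unfolding l1norm_def by (intro continuous_intros)

lemma borel_measurable_l1norm [measurable]: "l1norm \<in> borel_measurable borel"
  by (intro borel_measurable_continuous_onI continuous_intros)

lemma l1norm_nonneg [simp]: "0 \<le> l1norm x"
  by (simp add: l1norm_def sum_nonneg)

lemma l1norm_scaleR: "l1norm (c *\<^sub>R x) = \<bar>c\<bar> * l1norm x"
  by (simp add: l1norm_def abs_mult sum_distrib_left)

lemma closed_l1sphere: "closed (l1sphere :: (real ^ 'n) set)"
  unfolding l1sphere_def by (intro closed_Collect_eq continuous_intros)

lemma compact_l1sphere: "compact (l1sphere :: (real ^ 'n) set)"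
proof -
  have "norm x \<le> 1" if "x \<in> l1sphere" for x :: "real ^ 'n"
    using that norm_le_l1_cart[of x] by (simp add: l1sphere_def l1norm_def)
  then show ?thesis
    using closed_l1sphere by (auto simp: compact_eq_bounded_closed intro: boundedI)
qed

lemma closed_l1simplex: "closed (l1simplex :: (real ^ 'n) set)"
proof -
  have eq: "nonneg_orthant = (\<Inter>i. {x :: real ^ 'n. 0 \<le> x $ i})"
    by (auto simp: nonneg_orthant_def)
  have "closed (nonneg_orthant :: (real ^ 'n) set)"
    unfolding eq by (intro closed_INT ballI closed_Collect_le continuous_intros)
  then show ?thesis
    unfolding l1simplex_def by (intro closed_Int closed_l1sphere)
qed

lemma angle_in_l1simplex:
  assumes "x \<in> nonneg_orthant" "l1norm x \<noteq> 0"
  shows "x /\<^sub>R l1norm x \<in> l1simplex"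
  using assms by (simp add: l1simplex_def l1sphere_def nonneg_orthant_def l1norm_scaleR)

lemma continuous_on_simplex_mapping:
  fixes T :: "real ^ 'n \<Rightarrow> real ^ 'd"
  assumes "simplex_mapping T"
  shows "continuous_on l1simplex T"
proof -
  from assms obtain a where a: "a > 0"
    "\<And>x y. x \<in> l1simplex \<Longrightarrow> y \<in> l1simplex \<Longrightarrow> dist x y = a * dist (T x) (T y)"
    unfolding simplex_mapping_def by blast
  show ?thesis
    unfolding continuous_on_iff
  proof (intro ballI allI impI)
    fix x :: "real ^ 'n" and e :: real assume "x \<in> l1simplex" "0 < e"
    then show "\<exists>d>0. \<forall>x'\<in>l1simplex. dist x' x < d \<longrightarrow> dist (T x') (T x) < e"
      using a by (intro exI[of _ "a * e"]) auto
  qed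
qed

lemma borel_measurable_on_simplex:
  fixes T :: "real ^ 'n \<Rightarrow> real ^ 'd"
  assumes "simplex_mapping T"
  shows "on_simplex T \<in> borel_measurable borel"
  unfolding on_simplex_def[abs_def]
  using continuous_on_simplex_mapping[OF assms]
  by (intro borel_measurable_continuous_on_if borel_closed closed_l1simplex) auto

lemma borel_measurable_mapped_angle:
  fixes T :: "real ^ 'n \<Rightarrow> real ^ 'd"
  assumes "simplex_mapping T"
  shows "mapped_angle T \<in> borel_measurable borel"
proof -
  note [measurable] = borel_measurable_on_simplex[OF assms]
  show ?thesis unfolding mapped_angle_def[abs_def] by measurable
qed

lemma on_simplex_in_unit_cube: "simplex_mapping T \<Longrightarrow> on_simplex T x \<in> unit_cube"
  by (auto simp: on_simplex_def simplex_mapping_def unit_cube_def)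

text \<open>A continuous function between the indicators of \<open>[2 * a,\<infinity>]\<close> and \<open>(a,\<infinity>]\<close>: with it, test
  functions bound tail probabilities without any discussion of boundary sets.\<close>

definition cutoff :: "real \<Rightarrow> ereal \<Rightarrow> real" where
  "cutoff a r = real_of_ereal (min (ereal (2 * a)) (max (ereal a) r)) / a - 1"

lemma cutoff_ereal: "cutoff a (ereal x) = min (2 * a) (max a x) / a - 1"
  unfolding cutoff_def by (simp flip: ereal_min ereal_max)

lemma cutoff_PInf [simp]: "0 < a \<Longrightarrow> cutoff a \<infinity> = 1"
  and cutoff_MInf [simp]: "0 < a \<Longrightarrow> cutoff a (-\<infinity>) = 0"
  by (simp_all add: cutoff_def min_def max_def)

lemma cutoff_bounds:
  assumes "0 < a"
  shows "0 \<le> cutoff a r" "cutoff a r \<le> 1"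
  using assms by (cases r; simp add: cutoff_ereal field_simps)+

lemma cutoff_eq_0: "0 < a \<Longrightarrow> r \<le> ereal a \<Longrightarrow> cutoff a r = 0"
  by (cases r) (simp_all add: cutoff_ereal)

lemma cutoff_eq_1: "0 < a \<Longrightarrow> ereal (2 * a) \<le> r \<Longrightarrow> cutoff a r = 1"
  by (cases r) (simp_all add: cutoff_ereal)

lemma continuous_on_cutoff: "continuous_on UNIV (cutoff a)"
proof -
  have "continuous_on UNIV (\<lambda>r. real_of_ereal (min (ereal (2 * a)) (max (ereal a) r)))"
  \<comment> \<open>The conversion to a real is continuous only at finite values, which is why the
    argument is clamped to \<open>[a, 2 * a]\<close> before it is converted.\<close>
  proof (rule continuous_on_compose2[OF continuous_on_real])
    show "continuous_on UNIV (\<lambda>r. min (ereal (2 * a)) (max (ereal a) r))"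
      by (intro continuous_intros)
    show "(\<lambda>r. min (ereal (2 * a)) (max (ereal a) r)) ` UNIV \<subseteq> UNIV - {\<infinity>, -\<infinity>}"
      by (auto simp: min_def max_def split: if_splits)
  qed
  then show ?thesis
    unfolding cutoff_def[abs_def] divide_inverse by (intro continuous_intros)
qed

lemma sets_nu_alpha [measurable_cong, simp]: "sets (nu_alpha \<alpha>) = sets borel"
  by (simp add: nu_alpha_def)

lemma nn_integral_cutoff_le:
  assumes "0 < \<alpha>" "0 < a"
  shows "(\<integral>\<^sup>+r. ennreal (cutoff a r) \<partial>nu_alpha \<alpha>) \<le> ennreal (a powr - \<alpha>)"
proof -
  have "(\<integral>\<^sup>+r. ennreal (cutoff a r) \<partial>nu_alpha \<alpha>) \<le> (\<integral>\<^sup>+r. indicator {ereal a<..} r \<partial>nu_alpha \<alpha>)"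
    using assms cutoff_bounds(2) cutoff_eq_0[of a]
    by (intro nn_integral_mono) (auto simp: indicator_def not_less)
  also have "\<dots> = ennreal (a powr - \<alpha>)"
    using assms by (simp add: emeasure_nu_alpha)
  finally show ?thesis .
qed

lemma nn_integral_cutoff_pos:
  assumes "0 < \<alpha>" "0 < a"
  shows "0 < (\<integral>\<^sup>+r. ennreal (cutoff a r) \<partial>nu_alpha \<alpha>)"
proof -
  have "0 < ennreal ((2 * a) powr - \<alpha>)" using assms by simp
  also have "\<dots> = (\<integral>\<^sup>+r. indicator {ereal (2 * a)<..} r \<partial>nu_alpha \<alpha>)"
    using assms by (simp add: emeasure_nu_alpha)
  also have "\<dots> \<le> (\<integral>\<^sup>+r. ennreal (cutoff a r) \<partial>nu_alpha \<alpha>)"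
    using assms cutoff_eq_1[of a] by (intro nn_integral_mono) (auto simp: indicator_def)
  finally show ?thesis .
qed

text \<open>A test function that is a product of a radial and an angular factor makes the limit a
  product as well. Nonnegative integrals carry the computation, so Fubini asks for no integrability,
  and \<open>enn2real\<close> returns to real values at the end.\<close>

lemma (in prob_space) vague_tendsto_cutoff:
  fixes X :: "'a \<Rightarrow> real ^ 'n" and g :: "real ^ 'n \<Rightarrow> real"
  assumes X [measurable]: "random_variable borel X"
    and S: "prob_space S" "sets S = sets borel" "AE x in S. x \<in> l1sphere"
    and vague: "vague_tendsto_on ({0<..} \<times> l1sphere)
          (\<lambda>t. scale_measure (ennreal t)
             (distr M borel (\<lambda>\<omega>. (ereal (l1norm (X \<omega>) / b t), X \<omega> /\<^sub>R l1norm (X \<omega>)))))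
          (scale_measure (ennreal c) (nu_alpha \<alpha> \<Otimes>\<^sub>M S))"
    and g: "continuous_on UNIV g" "\<And>x. 0 \<le> g x" "\<And>x. g x \<le> 1"
    and a: "0 < a"
  shows "((\<lambda>t. t * (\<integral>\<omega>. cutoff a (ereal (l1norm (X \<omega>) / b t)) * g (X \<omega> /\<^sub>R l1norm (X \<omega>)) \<partial>M))
    \<longlongrightarrow> enn2real (ennreal c * (\<integral>\<^sup>+r. ennreal (cutoff a r) \<partial>nu_alpha \<alpha>) * (\<integral>\<^sup>+x. ennreal (g x) \<partial>S))) at_top"
proof -
  interpret S: prob_space S by fact
  note [measurable_cong] = S(2)
  define D :: "(ereal \<times> (real ^ 'n)) set" where "D = {0<..} \<times> l1sphere"
  define f where "f = (\<lambda>(r, x). cutoff a r * g x)"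
  define P where "P t \<omega> = (ereal (l1norm (X \<omega>) / b t), X \<omega> /\<^sub>R l1norm (X \<omega>))" for t \<omega>
  have [measurable]: "cutoff a \<in> borel_measurable borel" "g \<in> borel_measurable borel"
    by (intro borel_measurable_continuous_onI continuous_on_cutoff g)+
  have f_meas [measurable]: "f \<in> borel_measurable borel"
    unfolding f_def borel_prod[symmetric] by measurable
  have [measurable]: "D \<in> sets borel"
    unfolding D_def borel_prod[symmetric]
    by (intro pair_measureI) (auto intro: borel_closed closed_l1sphere)
  have [measurable]: "P t \<in> borel_measurable M" for t
    unfolding P_def borel_prod[symmetric] by measurable
  have f0: "0 \<le> f p" for p
    using cutoff_bounds[OF a] g by (auto simp: f_def split: prod.splits)
  have "continuous_on D f"
    unfolding f_def case_prod_beta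
    by (intro continuous_intros continuous_on_compose2[OF continuous_on_cutoff]
        continuous_on_compose2[OF g(1)]) auto
  moreover have "\<exists>K. compact K \<and> K \<subseteq> D \<and> (\<forall>p\<in>D - K. f p = 0)"
  proof (intro exI conjI ballI)
    \<comment> \<open>The ray contains \<infinity>, so it is a closed subset of the compact extended
      line.\<close>
    show "compact ({ereal a..} \<times> (l1sphere :: (real ^ 'n) set))"
      by (intro compact_Times compact_l1sphere) (simp add: compact_eq_closed)
    show "{ereal a..} \<times> l1sphere \<subseteq> D"
      using a by (auto simp: D_def intro: less_le_trans[of 0 "ereal a"])
    fix p assume "p \<in> D - {ereal a..} \<times> l1sphere"
    then show "f p = 0" using cutoff_eq_0[OF a, of "fst p"] linear[of "ereal a" "fst p"]
      by (auto simp: D_def f_def)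
  qed
  ultimately have lim: "((\<lambda>t. set_lebesgue_integral (scale_measure (ennreal t) (distr M borel (P t))) D f)
      \<longlongrightarrow> set_lebesgue_integral (scale_measure (ennreal c) (nu_alpha \<alpha> \<Otimes>\<^sub>M S)) D f) at_top"
    using vague f0 unfolding vague_tendsto_on_def D_def P_def by blast
  have lhs: "set_lebesgue_integral (scale_measure (ennreal t) (distr M borel (P t))) D f
      = t * (\<integral>\<omega>. cutoff a (ereal (l1norm (X \<omega>) / b t)) * g (X \<omega> /\<^sub>R l1norm (X \<omega>)) \<partial>M)" if t: "0 \<le> t" for t
  proof -
    \<comment> \<open>A point outside \<open>D\<close> has radial coordinate at most 0: the
      coordinate is 0 if the norm vanishes, and otherwise the angle is on the sphere, so only the
      radial condition can fail. There \<open>cutoff\<close> is 0, so restricting to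
      \<open>D\<close> changes nothing.\<close>
    have ind: "indicator D (P t \<omega>) * f (P t \<omega>) = f (P t \<omega>)" for \<omega>
    proof (cases "P t \<omega> \<in> D")
      case False
      then have "l1norm (X \<omega>) / b t \<le> 0"
        by (cases "l1norm (X \<omega>) = 0")
           (auto simp: D_def P_def l1sphere_def l1norm_scaleR not_less)
      then have "f (P t \<omega>) = 0" using a cutoff_eq_0[OF a] by (simp add: f_def P_def)
      then show ?thesis by simp
    qed simp
    have "set_lebesgue_integral (scale_measure (ennreal t) (distr M borel (P t))) D f
      = enn2real (\<integral>\<^sup>+p. ennreal (indicator D p *\<^sub>R f p) \<partial>scale_measure (ennreal t) (distr M borel (P t)))"
      unfolding set_lebesgue_integral_def
      using f0 by (intro integral_eq_nn_integral) auto
    also have "\<dots> = enn2real (ennreal t * (\<integral>\<^sup>+\<omega>. ennreal (f (P t \<omega>)) \<partial>M))"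
      by (subst nn_integral_scale_measure) (auto simp: nn_integral_distr ind)
    also have "\<dots> = t * enn2real (\<integral>\<^sup>+\<omega>. ennreal (f (P t \<omega>)) \<partial>M)"
      using t by (simp add: enn2real_mult)
    also have "enn2real (\<integral>\<^sup>+\<omega>. ennreal (f (P t \<omega>)) \<partial>M) = (\<integral>\<omega>. f (P t \<omega>) \<partial>M)"
      using f0 by (intro integral_eq_nn_integral[symmetric]) auto
    also have "(\<lambda>\<omega>. f (P t \<omega>)) = (\<lambda>\<omega>. cutoff a (ereal (l1norm (X \<omega>) / b t)) * g (X \<omega> /\<^sub>R l1norm (X \<omega>)))"
      by (simp add: f_def P_def)
    finally show ?thesis .
  qed
  have rhs: "set_lebesgue_integral (scale_measure (ennreal c) (nu_alpha \<alpha> \<Otimes>\<^sub>M S)) D f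
     = enn2real (ennreal c * (\<integral>\<^sup>+r. ennreal (cutoff a r) \<partial>nu_alpha \<alpha>) * (\<integral>\<^sup>+x. ennreal (g x) \<partial>S))"
  proof -
    have sets: "sets (nu_alpha \<alpha> \<Otimes>\<^sub>M S) = sets borel"
      unfolding borel_prod[symmetric] using S(2) by (intro sets_pair_measure_cong) auto
    note [measurable_cong] = sets
    have "set_lebesgue_integral (scale_measure (ennreal c) (nu_alpha \<alpha> \<Otimes>\<^sub>M S)) D f
      = enn2real (\<integral>\<^sup>+p. ennreal (indicator D p *\<^sub>R f p) \<partial>scale_measure (ennreal c) (nu_alpha \<alpha> \<Otimes>\<^sub>M S))"
      unfolding set_lebesgue_integral_def
      using f0 by (intro integral_eq_nn_integral) auto
    also have "\<dots> = enn2real (ennreal c * (\<integral>\<^sup>+p. ennreal (indicator D p *\<^sub>R f p) \<partial>(nu_alpha \<alpha> \<Otimes>\<^sub>M S)))"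
      by (subst nn_integral_scale_measure) auto
    also have "(\<integral>\<^sup>+p. ennreal (indicator D p *\<^sub>R f p) \<partial>(nu_alpha \<alpha> \<Otimes>\<^sub>M S))
       = (\<integral>\<^sup>+r. \<integral>\<^sup>+x. ennreal (indicator D (r, x) *\<^sub>R f (r, x)) \<partial>S \<partial>nu_alpha \<alpha>)"
      by (subst S.nn_integral_fst) auto
    also have "\<dots> = (\<integral>\<^sup>+r. \<integral>\<^sup>+x. ennreal (cutoff a r) * ennreal (g x) \<partial>S \<partial>nu_alpha \<alpha>)"
    proof (rule nn_integral_cong, rule nn_integral_cong_AE)
      fix r :: ereal
      have "cutoff a r = 0" if "r \<le> 0"
        using that a by (intro cutoff_eq_0) (auto intro: order_trans)
      then show "AE x in S. ennreal (indicator D (r, x) *\<^sub>R f (r, x)) = ennreal (cutoff a r) * ennreal (g x)"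
        using S(3) cutoff_bounds[OF a] g(2)
        by (auto simp: D_def f_def indicator_def ennreal_mult' not_less)
    qed
    also have "\<dots> = (\<integral>\<^sup>+r. ennreal (cutoff a r) \<partial>nu_alpha \<alpha>) * (\<integral>\<^sup>+x. ennreal (g x) \<partial>S)"
      by (simp add: nn_integral_cmult nn_integral_multc)
    finally show ?thesis by (simp add: mult.assoc)
  qed
  have "\<forall>\<^sub>F t in at_top. set_lebesgue_integral (scale_measure (ennreal t) (distr M borel (P t))) D f
      = t * (\<integral>\<omega>. cutoff a (ereal (l1norm (X \<omega>) / b t)) * g (X \<omega> /\<^sub>R l1norm (X \<omega>)) \<partial>M)"
    \<comment> \<open>For negative \<open>t\<close> the factor \<open>ennreal t\<close> would be
      truncated to 0.\<close>
    using eventually_ge_at_top[of 0] by eventually_elim (rule lhs)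
  from Lim_transform_eventually[OF lim this] show ?thesis unfolding rhs .
qed

text \<open>One level has to serve both estimates. Tail probabilities are squeezed by cutoffs with a
  common edge: \<open>cutoff a\<close> is 1 from \<open>2 * a\<close> on and bounds from above,
  while \<open>cutoff (2 * a)\<close> is 0 up to \<open>2 * a\<close> and bounds from below.\<close>

lemma (in prob_space) mrv_exceedance_levels:
  fixes X :: "'a \<Rightarrow> real ^ 'n" and T :: "real ^ 'n \<Rightarrow> real ^ 'd"
  assumes X [measurable]: "random_variable borel X"
    and nonneg: "AE \<omega> in M. X \<omega> \<in> nonneg_orthant"
    and mrv: "mrv_angular M X S"
    and T: "simplex_mapping T"
  obtains u :: "real \<Rightarrow> real" where
    "\<forall>\<^sub>F t in at_top. t * \<P>(\<omega> in M. u t < l1norm (X \<omega>)) \<le> 1 / 2"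
    "\<And>V. open V \<Longrightarrow> 0 \<notin> V \<Longrightarrow> 0 < emeasure (angular_image T S) V \<Longrightarrow>
       \<exists>q>0. \<forall>\<^sub>F t in at_top. q \<le> t * \<P>(\<omega> in M. u t < l1norm (X \<omega>) \<and> mapped_angle T (X \<omega>) \<in> V)"
proof -
  from mrv obtain b c \<alpha> where S: "prob_space S" "sets S = sets borel" "AE x in S. x \<in> l1sphere"
    and b: "filterlim b at_top at_top" and c: "0 < c" and \<alpha>: "0 < \<alpha>"
    and vague: "vague_tendsto_on ({0<..} \<times> l1sphere)
          (\<lambda>t. scale_measure (ennreal t)
             (distr M borel (\<lambda>\<omega>. (ereal (l1norm (X \<omega>) / b t), X \<omega> /\<^sub>R l1norm (X \<omega>)))))
          (scale_measure (ennreal c) (nu_alpha \<alpha> \<Otimes>\<^sub>M S))"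
    unfolding mrv_angular_def by blast
  interpret S: prob_space S by fact
  note [measurable_cong] = S(2)
  note [measurable] = borel_measurable_mapped_angle[OF T]
  have b_pos: "\<forall>\<^sub>F t in at_top. 0 < b t"
    using b by (simp add: filterlim_at_top_dense)
  have cutoff_meas [measurable]: "cutoff a \<in> borel_measurable borel" for a
    by (intro borel_measurable_continuous_onI continuous_on_cutoff)
  \<comment> \<open>Solves \<open>c * a powr - \<alpha> = 1 / 4\<close>, so that the limiting upper
    bound stays strictly below the target 1/2.\<close>
  define a where "a = (4 * c) powr (1 / \<alpha>)"
  have a: "0 < a" using c by (simp add: a_def)
  have a_powr: "c * a powr - \<alpha> = 1 / 4"
    using c \<alpha> by (simp add: a_def powr_powr powr_minus field_simps)
  \<comment> \<open>The common edge \<open>2 * a\<close> of the two cutoffs, in the scale of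
    \<open>b t\<close>.\<close>
  define u where "u t = 2 * a * b t" for t
  show ?thesis
  proof (rule that[of u])
    let ?I = "\<lambda>t. t * (\<integral>\<omega>. cutoff a (ereal (l1norm (X \<omega>) / b t)) * 1 \<partial>M)"
    define l where "l = enn2real (ennreal c * (\<integral>\<^sup>+r. ennreal (cutoff a r) \<partial>nu_alpha \<alpha>) * (\<integral>\<^sup>+x. ennreal 1 \<partial>S))"
    have "(?I \<longlongrightarrow> l) at_top"
      unfolding l_def by (rule vague_tendsto_cutoff[OF X S vague _ _ _ a]) auto
    moreover have "l \<le> enn2real (ennreal c * ennreal (a powr - \<alpha>))"
      unfolding l_def using nn_integral_cutoff_le[OF \<alpha> a]
      by (intro enn2real_mono) (auto simp: S.emeasure_space_1 ennreal_mult_less_top intro!: mult_left_mono)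
    then have "l < 1 / 2" using a_powr c by (simp add: ennreal_mult'[symmetric])
    ultimately have "\<forall>\<^sub>F t in at_top. ?I t < 1 / 2" by (rule order_tendstoD)
    then show "\<forall>\<^sub>F t in at_top. t * \<P>(\<omega> in M. u t < l1norm (X \<omega>)) \<le> 1 / 2"
      using b_pos eventually_ge_at_top[of 0]
    proof eventually_elim
      fix t assume t: "?I t < 1 / 2" "0 < b t" "0 \<le> t"
      have "\<P>(\<omega> in M. u t < l1norm (X \<omega>)) = (\<integral>\<omega>. indicator {\<omega>\<in>space M. u t < l1norm (X \<omega>)} \<omega> \<partial>M)"
        by simp
      also have "\<dots> \<le> (\<integral>\<omega>. cutoff a (ereal (l1norm (X \<omega>) / b t)) * 1 \<partial>M)"
      proof (rule integral_mono)
        show "integrable M (\<lambda>\<omega>. cutoff a (ereal (l1norm (X \<omega>) / b t)) * 1)"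
          using cutoff_bounds[OF a] by (intro integrable_const_bound[of _ 1]) auto
        fix \<omega> assume "\<omega> \<in> space M"
        show "indicator {\<omega>\<in>space M. u t < l1norm (X \<omega>)} \<omega> \<le> cutoff a (ereal (l1norm (X \<omega>) / b t)) * 1"
          using t cutoff_bounds[OF a] cutoff_eq_1[OF a]
          by (auto simp: indicator_def u_def field_simps)
      qed (auto intro!: integrable_real_indicator simp: less_top[symmetric])
      finally have "t * \<P>(\<omega> in M. u t < l1norm (X \<omega>)) \<le> ?I t"
        using t by (intro mult_left_mono) auto
      with t show "t * \<P>(\<omega> in M. u t < l1norm (X \<omega>)) \<le> 1 / 2" by linarith
    qed
  next
    fix V :: "(real ^ 'd) set"
    assume V: "open V" "0 \<notin> V" "0 < emeasure (angular_image T S) V"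
    have [measurable]: "V \<in> sets borel" using V by simp
    from continuous_on_simplex_mapping[OF T] V(1)
    obtain W where W: "open W" "W \<inter> l1simplex = T -` V \<inter> l1simplex"
      unfolding continuous_on_open_invariant by blast
    \<comment> \<open>Removing 0, which is not on the simplex, keeps the complement nonempty; the
      distance to an empty complement would be 0 by convention and \<open>g\<close> below would
      vanish.\<close>
    define O' where "O' = W - {0}"
    have O': "open O'" "0 \<notin> O'" using W by (auto simp: O'_def)
    have O'_iff: "x \<in> O' \<longleftrightarrow> on_simplex T x \<in> V" if "x \<in> l1simplex" for x
    proof -
      have "x \<noteq> 0" using that by (auto simp: l1simplex_def l1sphere_def l1norm_def)
      then show ?thesis using that W by (auto simp: O'_def on_simplex_def)
    qed
    \<comment> \<open>A continuous function with values in [0,1] that is positive exactly on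
      \<open>O'\<close>, hence a minorant of its indicator.\<close>
    define g where "g x = min 1 (infdist x (- O'))" for x
    have ne: "- O' \<noteq> {}" and cl: "closed (- O')" using O' by (auto simp: closed_Compl)
    have g0: "g x = 0 \<longleftrightarrow> x \<notin> O'" for x
      using in_closed_iff_infdist_zero[OF cl ne, of x] by (auto simp: g_def min_def)
    have g: "continuous_on UNIV g" "\<And>x. 0 \<le> g x" "\<And>x. g x \<le> 1"
      unfolding g_def by (auto intro!: continuous_intros infdist_nonneg)
    have g_meas [measurable]: "g \<in> borel_measurable borel"
      by (intro borel_measurable_continuous_onI g)
    have "emeasure (angular_image T S) V = emeasure S (on_simplex T -` V \<inter> space S)"
      unfolding angular_image_def using borel_measurable_on_simplex[OF T] S(2)
      by (subst emeasure_distr) (auto cong: measurable_cong_sets)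
    moreover have sub: "on_simplex T -` V \<subseteq> O'"
      \<comment> \<open>Off the simplex the masked map is 0, which \<open>V\<close> does not
        contain.\<close>
      using V(2) O'_iff by (auto simp: on_simplex_def split: if_splits)
    ultimately have "0 < emeasure S O'"
      using V(3) O'(1) S(2)
      by (metis emeasure_mono order_less_le_trans le_infI1 borel_open)
    have g_pos: "0 < (\<integral>\<^sup>+x. ennreal (g x) \<partial>S)"
    proof (rule ccontr)
      assume "\<not> 0 < (\<integral>\<^sup>+x. ennreal (g x) \<partial>S)"
      then have "AE x in S. ennreal (g x) = 0"
        by (subst nn_integral_0_iff_AE[symmetric]) auto
      then have "AE x in S. x \<notin> O'" using g(2) g0 by (auto simp: ennreal_eq_0_iff order_antisym_conv)
      then have "emeasure S O' = 0"
        using O'(1) S(2) by (subst (asm) AE_iff_measurable[of O']) (auto dest: sets_eq_imp_space_eq)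
      with \<open>0 < emeasure S O'\<close> show False by simp
    qed
    let ?I = "\<lambda>t. t * (\<integral>\<omega>. cutoff (2 * a) (ereal (l1norm (X \<omega>) / b t)) * g (X \<omega> /\<^sub>R l1norm (X \<omega>)) \<partial>M)"
    define l where "l = enn2real (ennreal c * (\<integral>\<^sup>+r. ennreal (cutoff (2 * a) r) \<partial>nu_alpha \<alpha>) * (\<integral>\<^sup>+x. ennreal (g x) \<partial>S))"
    have a2: "0 < 2 * a" using a by simp
    have lim: "(?I \<longlongrightarrow> l) at_top"
      unfolding l_def by (rule vague_tendsto_cutoff[OF X S vague g a2])
    have "(\<integral>\<^sup>+x. ennreal (g x) \<partial>S) \<le> (\<integral>\<^sup>+x. 1 \<partial>S)"
      using g by (intro nn_integral_mono) auto
    then have "(\<integral>\<^sup>+x. ennreal (g x) \<partial>S) < \<top>"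
      by (rule le_less_trans) (simp add: S.emeasure_space_1)
    moreover have "(\<integral>\<^sup>+r. ennreal (cutoff (2 * a) r) \<partial>nu_alpha \<alpha>) < \<top>"
      by (rule le_less_trans[OF nn_integral_cutoff_le[OF \<alpha> a2]]) simp
    ultimately have "0 < l"
      unfolding l_def using g_pos nn_integral_cutoff_pos[OF \<alpha> a2] c
      by (auto simp: enn2real_positive_iff ennreal_mult_less_top ennreal_zero_less_mult_iff)
    moreover from this have "\<forall>\<^sub>F t in at_top. l / 2 < ?I t"
      using lim by (intro order_tendstoD) auto
    then have "\<forall>\<^sub>F t in at_top. l / 2 \<le> t * \<P>(\<omega> in M. u t < l1norm (X \<omega>) \<and> mapped_angle T (X \<omega>) \<in> V)"
      using b_pos eventually_ge_at_top[of 0]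
    proof eventually_elim
      fix t assume t: "l / 2 < ?I t" "0 < b t" "0 \<le> t"
      let ?A = "{\<omega>\<in>space M. u t < l1norm (X \<omega>) \<and> mapped_angle T (X \<omega>) \<in> V}"
      have "(\<integral>\<omega>. cutoff (2 * a) (ereal (l1norm (X \<omega>) / b t)) * g (X \<omega> /\<^sub>R l1norm (X \<omega>)) \<partial>M)
        \<le> (\<integral>\<omega>. indicator ?A \<omega> \<partial>M)"
      proof (rule integral_mono_AE)
        show "integrable M (\<lambda>\<omega>. cutoff (2 * a) (ereal (l1norm (X \<omega>) / b t)) * g (X \<omega> /\<^sub>R l1norm (X \<omega>)))"
          using cutoff_bounds[OF a2] g
          by (intro integrable_const_bound[of _ 1]) (auto intro!: AE_I2 mult_le_one simp: abs_mult)
        show "AE \<omega> in M. cutoff (2 * a) (ereal (l1norm (X \<omega>) / b t)) * g (X \<omega> /\<^sub>R l1norm (X \<omega>)) \<le> indicator ?A \<omega>"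
          using nonneg AE_space
        proof eventually_elim
          case (elim \<omega>)
          show ?case
          proof (cases "\<omega> \<in> ?A")
            case True
            then show ?thesis using cutoff_bounds[OF a2] g by (auto intro: mult_le_one)
          next
            case False
            show ?thesis
            proof (cases "u t < l1norm (X \<omega>)")
              case True
              then have "l1norm (X \<omega>) \<noteq> 0" using t a by (auto simp: u_def mult_less_0_iff)
              then have "X \<omega> /\<^sub>R l1norm (X \<omega>) \<in> l1simplex" by (rule angle_in_l1simplex[OF elim(1)])
              then have "g (X \<omega> /\<^sub>R l1norm (X \<omega>)) = 0"
                using False True elim(2) O'_iff by (auto simp: g0 mapped_angle_def)
              then show ?thesis by simp
            next
              case F: False
              then have "cutoff (2 * a) (ereal (l1norm (X \<omega>) / b t)) = 0"
                using t by (intro cutoff_eq_0[OF a2]) (auto simp: u_def field_simps)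
              then show ?thesis by simp
            qed
          qed
        qed
      qed (auto intro!: integrable_real_indicator simp: less_top[symmetric])
      also have "\<dots> = prob ?A" by simp
      finally have "?I t \<le> t * prob ?A" using t by (intro mult_left_mono) auto
      with t show "l / 2 \<le> t * prob ?A" by linarith
    qed
    ultimately show "\<exists>q>0. \<forall>\<^sub>F t in at_top. q \<le> t * \<P>(\<omega> in M. u t < l1norm (X \<omega>) \<and> mapped_angle T (X \<omega>) \<in> V)"
      by (intro exI[of _ "l / 2"]) auto
  qed
qed

section \<open>Deterministic bounds for the support estimator\<close>

text \<open>Only finitely many cells are hit, so closing their union adds no more than closing each
  of them. Every point of the estimator is then within one cell diameter of some mapped
  angle.\<close>

lemma tsupp_hat_subset_delta_nbhd:
  fixes T :: "real ^ 'n \<Rightarrow> real ^ 'd"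
  assumes K: "closed K" "K \<noteq> {}"
    and near: "\<And>i. i \<in> exceedances z n k \<Longrightarrow> infdist (mapped_angle T (z i)) K \<le> \<eta>"
    and \<delta>: "\<eta> + real CARD('d) / real m < \<delta>"
  shows "tsupp_hat T z n k m \<subseteq> delta_nbhd K \<delta>"
proof
  fix y assume "y \<in> tsupp_hat T z n k m"
  moreover have "tsupp_hat T z n k m \<subseteq> (\<Union>x\<in>hit_cells T z n k m. closure (cell x m))"
    unfolding tsupp_hat_eq
    by (intro closure_minimal UN_mono closure_subset closed_UN) auto
  ultimately obtain x i where x: "y \<in> closure (cell x m)"
    and i: "i \<in> exceedances z n k" "mapped_angle T (z i) \<in> cell x m"
    by (auto simp: hit_cells_def)
  obtain v where v: "v \<in> K" "infdist (mapped_angle T (z i)) K = dist (mapped_angle T (z i)) v"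
    using infdist_attains_inf[OF K] by blast
  have "dist y v \<le> dist y (mapped_angle T (z i)) + dist (mapped_angle T (z i)) v"
    by (rule dist_triangle)
  also have "\<dots> < \<delta>"
    using dist_closure_cell_le[OF x i(2)] near[OF i(1)] v(2) \<delta> by linarith
  finally show "y \<in> delta_nbhd K \<delta>" using v(1) by (auto simp: delta_nbhd_def)
qed

text \<open>Two grids are at work: \<open>l\<close> measures how well mapped angles fill
  \<open>K\<close>, and \<open>m\<close> belongs to the estimator. Points in cells have coordinates
  below 1, so an angle in a cell of the first grid also lies in a cell of the second, hence in the
  estimator.\<close>

lemma subset_delta_nbhd_tsupp_hat:
  fixes T :: "real ^ 'n \<Rightarrow> real ^ 'd"
  assumes K: "K \<subseteq> unit_cube"
    and pos: "0 < l" "0 < m" "0 < k"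
    and hit: "\<And>g. g \<in> grid l \<Longrightarrow> K \<inter> closure (cell g l) \<noteq> {} \<Longrightarrow>
      \<exists>i\<in>exceedances z n k. mapped_angle T (z i) \<in> cell g l"
    and \<delta>: "real CARD('d) / real l < \<delta>"
  shows "K \<subseteq> delta_nbhd (tsupp_hat T z n k m) \<delta>"
proof
  fix y assume y: "y \<in> K"
  with K obtain g where g: "g \<in> grid l" "y \<in> closure (cell g l)"
    using unit_cube_subset_closure_cells[OF pos(1), of y] by auto
  with y hit obtain i where i: "i \<in> exceedances z n k" "mapped_angle T (z i) \<in> cell g l"
    by blast
  obtain x where "x \<in> grid m" "mapped_angle T (z i) \<in> cell x m"
    using half_open_cube_subset_cells[OF pos(2), of "mapped_angle T (z i)"]
      cell_subset_unit_cube[OF g(1)] i(2) by blast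
  then have "mapped_angle T (z i) \<in> tsupp_hat T z n k m"
    unfolding tsupp_hat_eq using i(1) pos(3)
    by (intro subsetD[OF closure_subset]) (auto simp: hit_cells_def)
  moreover have "dist y (mapped_angle T (z i)) < \<delta>"
    using dist_closure_cell_le[OF g(2) i(2)] \<delta> by linarith
  ultimately show "y \<in> delta_nbhd (tsupp_hat T z n k m) \<delta>"
    by (auto simp: delta_nbhd_def)
qed

lemma hausdorff_dist_le:
  assumes "0 < \<delta>" "A \<subseteq> delta_nbhd B \<delta>" "B \<subseteq> delta_nbhd A \<delta>"
  shows "hausdorff_dist A B \<le> ennreal \<delta>"
  unfolding hausdorff_dist_def using assms by (intro Inf_lower) auto

lemma hausdorff_dist_commute: "hausdorff_dist A B = hausdorff_dist B A"
  unfolding hausdorff_dist_def by (rule arg_cong[where f = Inf]) auto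

section \<open>Measurability\<close>

text \<open>With finitely many possible values it is enough to treat single values. As every set is
  measurable in the target, any function of \<open>H\<close> can be composed afterwards, in
  particular arbitrary functionals on compact sets.\<close>

lemma measurable_finite_set_valued:
  assumes "finite G" "\<And>\<omega>. H \<omega> \<subseteq> G" "\<And>x. x \<in> G \<Longrightarrow> Measurable.pred M (\<lambda>\<omega>. x \<in> H \<omega>)"
  shows "H \<in> measurable M (count_space UNIV)"
proof -
  have "H \<in> measurable M (count_space (Pow G))"
    unfolding measurable_count_space_eq2[OF finite_Pow_iff[THEN iffD2, OF assms(1)]]
  proof safe
    fix A assume "A \<subseteq> G"
    then have "H -` {A} \<inter> space M = {\<omega>\<in>space M. \<forall>x\<in>G. x \<in> H \<omega> \<longleftrightarrow> x \<in> A}"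
      using assms(2) by blast
    also have "\<dots> \<in> sets M"
    proof (rule sets.sets_Collect_finite_All[OF _ assms(1)])
      fix x assume "x \<in> G"
      note [measurable] = assms(3)[OF this]
      show "{\<omega>\<in>space M. (x \<in> H \<omega>) = (x \<in> A)} \<in> sets M" by measurable
    qed
    finally show "H -` {A} \<inter> space M \<in> sets M" .
  qed (use assms(2) in auto)
  then show ?thesis by (rule measurable_compose) (simp add: measurable_count_space_eq1)
qed

lemma measurable_from_count_space:
  "H \<in> measurable M (count_space UNIV) \<Longrightarrow> (\<And>x. F x \<in> space N) \<Longrightarrow> (\<lambda>\<omega>. F (H \<omega>)) \<in> measurable M N"
  by (rule measurable_compose[of H _ "count_space UNIV"]) (auto simp: measurable_count_space_eq1)

abbreviation samples :: "(nat \<Rightarrow> real ^ 'n) measure" where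
  "samples \<equiv> PiM UNIV (\<lambda>_. borel)"

lemma measurable_in_exceedances:
  assumes "k < n"
  shows "Measurable.pred (samples :: (nat \<Rightarrow> real ^ 'n) measure) (\<lambda>z. i \<in> exceedances z n k)"
proof -
  have comp [measurable]: "(\<lambda>z. l1norm (z j)) \<in> borel_measurable (samples :: (nat \<Rightarrow> real ^ 'n) measure)" for j
    by (rule measurable_compose[OF measurable_component_singleton[of j UNIV "\<lambda>_. borel"]
          borel_measurable_l1norm]) simp
  have card: "(\<lambda>z :: nat \<Rightarrow> real ^ 'n. card {j. j < n \<and> l1norm (z i) \<le> l1norm (z j)})
      \<in> measurable samples (count_space UNIV)"
  proof (rule measurable_card)
    fix j
    have [measurable]: "Measurable.pred samples (\<lambda>z :: nat \<Rightarrow> real ^ 'n. l1norm (z i) \<le> l1norm (z j))"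
      unfolding pred_def by (rule borel_measurable_le) (rule comp)+
    show "{z \<in> space samples. j \<in> {j. j < n \<and> l1norm (z i :: real ^ 'n) \<le> l1norm (z j)}} \<in> sets samples"
      unfolding mem_Collect_eq by measurable
  qed
  show ?thesis
    unfolding exceedances_eq[OF assms] mem_Collect_eq
    by (rule measurable_compose[OF card, of "\<lambda>c. i < n \<and> c \<le> k"]) simp
qed

lemma measurable_exceedances:
  assumes "k < n"
  shows "(\<lambda>z. exceedances z n k) \<in> measurable samples (count_space UNIV)"
proof (rule measurable_finite_set_valued)
  show "exceedances z n k \<subseteq> {..<n}" for z by (rule exceedances_subset)
  show "Measurable.pred samples (\<lambda>z. i \<in> exceedances z n k)" for i
    by (rule measurable_in_exceedances[OF assms])
qed simp

lemma measurable_tsupp_hat: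
  fixes T :: "real ^ 'n \<Rightarrow> real ^ 'd"
  assumes T: "simplex_mapping T" and "k < n"
  shows "(\<lambda>z. tsupp_hat T z n k m) \<in> measurable samples (count_space UNIV)"
proof -
  note [measurable] = borel_measurable_mapped_angle[OF T] measurable_in_exceedances[OF \<open>k < n\<close>]
  have "(\<lambda>z. hit_cells T z n k m) \<in> measurable samples (count_space UNIV)"
  proof (rule measurable_finite_set_valued[OF finite_grid])
    show "hit_cells T z n k m \<subseteq> grid m" for z by (auto simp: hit_cells_def)
    show "Measurable.pred samples (\<lambda>z. x \<in> hit_cells T z n k m)" if "x \<in> grid m" for x
    proof -
      have "(\<lambda>z. x \<in> hit_cells T z n k m) =
          (\<lambda>z. 0 < k \<and> (\<exists>i\<in>{..<n}. i \<in> exceedances z n k \<and> mapped_angle T (z i) \<in> cell x m))"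
        using that exceedances_subset by (fastforce simp: hit_cells_def)
      also have "Measurable.pred samples \<dots>"
        by measurable
      finally show ?thesis .
    qed
  qed
  then show ?thesis
    unfolding tsupp_hat_eq by (rule measurable_from_count_space) auto
qed

section \<open>Samples of independent, identically distributed vectors\<close>

locale iid_vectors = prob_space M for M :: "'a measure" +
  fixes Z :: "nat \<Rightarrow> 'a \<Rightarrow> real ^ 'n"
  assumes indep: "indep_vars (\<lambda>_. borel) Z UNIV"
    and ident: "\<And>i. distr M borel (Z i) = distr M borel (Z 0)"
begin

lemma Z_measurable [measurable]: "Z i \<in> borel_measurable M"
  using indep by (simp add: indep_vars_def)

lemma sample_measurable [measurable]: "(\<lambda>\<omega> i. Z i \<omega>) \<in> measurable M samples"
  by (rule measurable_PiM_single') auto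

lemma distr_sample: "distr M samples (\<lambda>\<omega> i. Z i \<omega>) = PiM UNIV (\<lambda>_. distr M borel (Z 0))"
proof -
  have "distr M samples (\<lambda>\<omega> i. Z i \<omega>) = PiM UNIV (\<lambda>i. distr M borel (Z i))"
    using indep_vars_iff_distr_eq_PiM[where I = UNIV and M' = "\<lambda>_. borel" and X = Z] indep
    by (simp add: restrict_UNIV)
  also have "(\<lambda>i. distr M borel (Z i)) = (\<lambda>_. distr M borel (Z 0))"
    by (rule ext) (rule ident)
  finally show ?thesis .
qed

text \<open>The law of the sequence is a product of equal factors, which injective relabelling of
  coordinates preserves. It is applied to transpositions.\<close>

lemma prob_reindex:
  assumes "inj f" and P [measurable]: "Measurable.pred samples P"
  shows "\<P>(\<omega> in M. P (\<lambda>i. Z (f i) \<omega>)) = \<P>(\<omega> in M. P (\<lambda>i. Z i \<omega>))"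
proof -
  let ?Q = "PiM UNIV (\<lambda>_. distr M borel (Z 0))"
  have sets [measurable_cong]: "sets ?Q = sets samples"
    by (intro sets_PiM_cong) auto
  have [measurable]: "(\<lambda>z i. z (f i)) \<in> measurable samples samples"
    by (rule measurable_PiM_single') auto
  have "?Q = distr ?Q ?Q (\<lambda>z i. z (f i))"
    using distr_PiM_reindex[of UNIV "\<lambda>_. distr M borel (Z 0)" f UNIV] assms(1)
    by (simp add: restrict_UNIV prob_space_distr)
  also have "\<dots> = distr (distr M samples (\<lambda>\<omega> i. Z i \<omega>)) samples (\<lambda>z i. z (f i))"
    unfolding distr_sample by (rule distr_cong) (auto simp: sets)
  also have "\<dots> = distr M samples (\<lambda>\<omega> i. Z (f i) \<omega>)"
    by (subst distr_distr) (auto simp: comp_def)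
  finally have eq: "distr M samples (\<lambda>\<omega> i. Z i \<omega>) = distr M samples (\<lambda>\<omega> i. Z (f i) \<omega>)"
    by (simp add: distr_sample)
  have [measurable]: "(\<lambda>\<omega> i. Z (f i) \<omega>) \<in> measurable M samples"
    by (rule measurable_PiM_single') auto
  have "\<P>(\<omega> in M. P (\<lambda>i. Z (g i) \<omega>)) = measure (distr M samples (\<lambda>\<omega> i. Z (g i) \<omega>)) {z\<in>space samples. P z}"
    if [measurable]: "(\<lambda>\<omega> i. Z (g i) \<omega>) \<in> measurable M samples" for g
    using P by (subst measure_distr) (auto simp: pred_def space_PiM intro!: arg_cong[where f = prob])
  from this[of f] this[of id] eq show ?thesis by simp
qed

lemma sets_some_exceedance_in:
  assumes [measurable]: "A \<in> sets borel" and "k < n"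
  shows "{\<omega>\<in>space M. \<exists>i\<in>exceedances (\<lambda>i. Z i \<omega>) n k. Z i \<omega> \<in> A} \<in> sets M"
proof -
  have [measurable]: "Measurable.pred M (\<lambda>\<omega>. i \<in> exceedances (\<lambda>i. Z i \<omega>) n k)" for i
    by (rule measurable_compose[OF sample_measurable measurable_in_exceedances[OF \<open>k < n\<close>]])
  have "{\<omega>\<in>space M. \<exists>i\<in>{..<n}. i \<in> exceedances (\<lambda>i. Z i \<omega>) n k \<and> Z i \<omega> \<in> A} \<in> sets M"
    by measurable
  also have "{\<omega>\<in>space M. \<exists>i\<in>{..<n}. i \<in> exceedances (\<lambda>i. Z i \<omega>) n k \<and> Z i \<omega> \<in> A}
      = {\<omega>\<in>space M. \<exists>i\<in>exceedances (\<lambda>i. Z i \<omega>) n k. Z i \<omega> \<in> A}"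
    using exceedances_subset by blast
  finally show ?thesis .
qed

text \<open>Both tail bounds below are expectations of such products: \<open>h\<close> is the
  indicator of \<open>- A\<close> for the event of no hit, and \<open>1 + indicator A\<close> for
  \<open>2\<close> to the number of hits.\<close>

lemma expectation_prod:
  fixes h :: "real ^ 'n \<Rightarrow> real"
  assumes [measurable]: "h \<in> borel_measurable borel" and bound: "\<And>x. \<bar>h x\<bar> \<le> c"
  shows "(\<integral>\<omega>. (\<Prod>i<n. h (Z i \<omega>)) \<partial>M) = (\<integral>\<omega>. h (Z 0 \<omega>) \<partial>M) ^ n"
proof -
  have "indep_vars (\<lambda>_. borel) (\<lambda>i \<omega>. h (Z i \<omega>)) {..<n}"
    by (rule indep_vars_compose2[OF indep_vars_subset[OF indep]]) auto
  moreover have "integrable M (\<lambda>\<omega>. h (Z i \<omega>))" for i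
    using bound by (intro integrable_const_bound[of _ c]) auto
  ultimately have "(\<integral>\<omega>. (\<Prod>i<n. h (Z i \<omega>)) \<partial>M) = (\<Prod>i<n. \<integral>\<omega>. h (Z i \<omega>) \<partial>M)"
    by (intro indep_vars_lebesgue_integral) auto
  also have "\<dots> = (\<Prod>i<n. \<integral>\<omega>. h (Z 0 \<omega>) \<partial>M)"
  proof (rule prod.cong[OF refl])
    fix i
    have "(\<integral>\<omega>. h (Z j \<omega>) \<partial>M) = (\<integral>x. h x \<partial>distr M borel (Z j))" for j
      by (subst integral_distr) auto
    then show "(\<integral>\<omega>. h (Z i \<omega>) \<partial>M) = (\<integral>\<omega>. h (Z 0 \<omega>) \<partial>M)" using ident by metis
  qed
  finally show ?thesis by simp
qed

lemma prob_all_notin_le: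
  assumes [measurable]: "A \<in> sets borel"
  shows "\<P>(\<omega> in M. \<forall>i<n. Z i \<omega> \<notin> A) \<le> exp (- (real n * \<P>(\<omega> in M. Z 0 \<omega> \<in> A)))"
proof -
  let ?p = "\<P>(\<omega> in M. Z 0 \<omega> \<in> A)"
  have "\<P>(\<omega> in M. \<forall>i<n. Z i \<omega> \<notin> A) = (\<integral>\<omega>. indicator {\<omega>\<in>space M. \<forall>i<n. Z i \<omega> \<notin> A} \<omega> \<partial>M)"
    by simp
  also have "\<dots> = (\<integral>\<omega>. (\<Prod>i<n. indicator (- A) (Z i \<omega>)) \<partial>M)"
    by (intro Bochner_Integration.integral_cong) (auto simp: indicator_def)
  also have "\<dots> = (\<integral>\<omega>. indicator (- A) (Z 0 \<omega>) \<partial>M) ^ n"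
    by (rule expectation_prod[where c = 1]) (auto simp: indicator_def)
  also have "(\<integral>\<omega>. indicator (- A) (Z 0 \<omega>) \<partial>M) = (\<integral>\<omega>. indicator {\<omega>\<in>space M. \<not> Z 0 \<omega> \<in> A} \<omega> \<partial>M :: real)"
    by (intro Bochner_Integration.integral_cong) (auto simp: indicator_def)
  also have "\<dots> = 1 - ?p"
    by (subst prob_neg[symmetric]) auto
  also have "(1 - ?p) ^ n \<le> exp (- ?p) ^ n"
    using exp_ge_add_one_self[of "- ?p"] by (intro power_mono) auto
  also have "\<dots> = exp (- (real n * ?p))"
    by (simp add: exp_of_nat_mult[symmetric])
  finally show ?thesis .
qed

text \<open>The Markov inequality for \<open>2\<close> to the power of the number of hits.\<close>

lemma prob_card_gt_le:
  assumes [measurable]: "A \<in> sets borel"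
  shows "\<P>(\<omega> in M. k < card {i. i < n \<and> Z i \<omega> \<in> A}) \<le> exp (real n * \<P>(\<omega> in M. Z 0 \<omega> \<in> A)) / 2 ^ k"
proof -
  let ?p = "\<P>(\<omega> in M. Z 0 \<omega> \<in> A)" and ?E = "{\<omega>\<in>space M. k < card {i. i < n \<and> Z i \<omega> \<in> A}}"
  let ?h = "\<lambda>x. 1 + indicator A x :: real"
  have prod: "(\<Prod>i<n. ?h (Z i \<omega>)) = 2 ^ card {i. i < n \<and> Z i \<omega> \<in> A}" for \<omega>
  proof -
    have "(\<Prod>i<n. ?h (Z i \<omega>)) = (\<Prod>i<n. if Z i \<omega> \<in> A then 2 else 1)"
      by (intro prod.cong) (auto simp: indicator_def)
    also have "\<dots> = 2 ^ card {i. i < n \<and> Z i \<omega> \<in> A}"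
      by (subst prod.inter_filter[symmetric]) auto
    finally show ?thesis .
  qed
  have "2 ^ k * prob ?E = (\<integral>\<omega>. 2 ^ k * indicator ?E \<omega> \<partial>M)"
    by simp
  also have "\<dots> \<le> (\<integral>\<omega>. (\<Prod>i<n. ?h (Z i \<omega>)) \<partial>M)"
  proof (rule integral_mono)
    have "(2::real) ^ card {i. i < n \<and> Z i \<omega> \<in> A} \<le> 2 ^ n" for \<omega>
      using card_mono[of "{..<n}" "{i. i < n \<and> Z i \<omega> \<in> A}"] by (intro power_increasing) auto
    then show "integrable M (\<lambda>\<omega>. \<Prod>i<n. ?h (Z i \<omega>))"
      by (intro integrable_const_bound[of _ "2 ^ n"]) (auto simp: prod)
    fix \<omega>
    show "2 ^ k * indicator ?E \<omega> \<le> (\<Prod>i<n. ?h (Z i \<omega>))"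
      unfolding prod by (auto simp: indicator_def intro: power_increasing)
  qed (auto intro!: integrable_real_indicator integrable_mult_right simp: less_top[symmetric])
  also have "\<dots> = (\<integral>\<omega>. ?h (Z 0 \<omega>) \<partial>M) ^ n"
    by (rule expectation_prod[where c = 2]) (auto simp: indicator_def)
  also have "(\<integral>\<omega>. ?h (Z 0 \<omega>) \<partial>M) = (\<integral>\<omega>. 1 + indicator {\<omega>\<in>space M. Z 0 \<omega> \<in> A} \<omega> \<partial>M)"
    by (intro Bochner_Integration.integral_cong) (auto simp: indicator_def)
  also have "\<dots> = 1 + ?p"
    by (subst Bochner_Integration.integral_add)
       (auto intro!: integrable_real_indicator simp: less_top[symmetric] prob_space)
  also have "(1 + ?p) ^ n \<le> exp ?p ^ n"
    using exp_ge_add_one_self[of ?p] by (intro power_mono) auto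
  also have "\<dots> = exp (real n * ?p)"
    by (simp add: exp_of_nat_mult[symmetric])
  finally show ?thesis by (simp add: field_simps)
qed

text \<open>All sample points above \<open>u\<close> are exceedances unless there are more than \<open>k\<close> of them.\<close>

lemma prob_no_exceedance_in_le:
  assumes [measurable]: "A \<in> sets borel" and kn: "k < n" and A: "\<And>x. x \<in> A \<Longrightarrow> u < l1norm x"
  shows "\<P>(\<omega> in M. \<not> (\<exists>i\<in>exceedances (\<lambda>i. Z i \<omega>) n k. Z i \<omega> \<in> A))
    \<le> exp (real n * \<P>(\<omega> in M. u < l1norm (Z 0 \<omega>))) / 2 ^ k + exp (- (real n * \<P>(\<omega> in M. Z 0 \<omega> \<in> A)))"
proof -
  let ?B = "{x :: real ^ 'n. u < l1norm x}"
  have B [measurable]: "?B \<in> sets borel" by measurable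
  have "{\<omega>\<in>space M. \<not> (\<exists>i\<in>exceedances (\<lambda>i. Z i \<omega>) n k. Z i \<omega> \<in> A)}
     \<subseteq> {\<omega>\<in>space M. k < card {i. i < n \<and> Z i \<omega> \<in> ?B}} \<union> {\<omega>\<in>space M. \<forall>i<n. Z i \<omega> \<notin> A}"
  proof (rule subsetI, rule ccontr)
    fix \<omega>
    assume "\<omega> \<in> {\<omega>\<in>space M. \<not> (\<exists>i\<in>exceedances (\<lambda>i. Z i \<omega>) n k. Z i \<omega> \<in> A)}"
      and "\<omega> \<notin> {\<omega>\<in>space M. k < card {i. i < n \<and> Z i \<omega> \<in> ?B}} \<union> {\<omega>\<in>space M. \<forall>i<n. Z i \<omega> \<notin> A}"
    then obtain i where no: "\<not> (\<exists>i\<in>exceedances (\<lambda>i. Z i \<omega>) n k. Z i \<omega> \<in> A)"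
      and le: "\<not> k < card {i. i < n \<and> Z i \<omega> \<in> ?B}" and i: "i < n" "Z i \<omega> \<in> A"
      by auto
    \<comment> \<open>Whatever has norm at least that of \<open>Z i\<close> also lies above
      \<open>u\<close>, so at most \<open>k\<close> points do, and \<open>i\<close> is an exceedance
      by the counting form.\<close>
    have "card {j. j < n \<and> l1norm (Z i \<omega>) \<le> l1norm (Z j \<omega>)} \<le> card {i. i < n \<and> Z i \<omega> \<in> ?B}"
      using A[OF i(2)] by (intro card_mono) auto
    then have "i \<in> exceedances (\<lambda>i. Z i \<omega>) n k"
      using le i(1) by (simp add: exceedances_eq[OF kn])
    with no i(2) show False by blast
  qed
  then have "\<P>(\<omega> in M. \<not> (\<exists>i\<in>exceedances (\<lambda>i. Z i \<omega>) n k. Z i \<omega> \<in> A))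
    \<le> prob ({\<omega>\<in>space M. k < card {i. i < n \<and> Z i \<omega> \<in> ?B}} \<union> {\<omega>\<in>space M. \<forall>i<n. Z i \<omega> \<notin> A})"
    by (intro finite_measure_mono) auto
  also have "\<dots> \<le> \<P>(\<omega> in M. k < card {i. i < n \<and> Z i \<omega> \<in> ?B}) + \<P>(\<omega> in M. \<forall>i<n. Z i \<omega> \<notin> A)"
    by (intro measure_Un_le) auto
  also have "\<dots> \<le> exp (real n * \<P>(\<omega> in M. u < l1norm (Z 0 \<omega>))) / 2 ^ k + exp (- (real n * \<P>(\<omega> in M. Z 0 \<omega> \<in> A)))"
    using prob_card_gt_le[OF B, of k n] prob_all_notin_le[of A n] by simp
  finally show ?thesis .
qed

text \<open>On \<open>{exceedances = I}\<close> the vectors \<open>(Z i)\<^sub>i\<^sub>\<in>\<^sub>I\<close> are exchangeable, so each of them is as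
  likely to lie in \<open>A\<close> as the first one; this needs no conditioning on the order statistic and is
  not affected by ties.\<close>

lemma prob_some_exceedance_in_le:
  assumes [measurable]: "A \<in> sets borel" and kn: "k < n"
  shows "\<P>(\<omega> in M. \<exists>i\<in>exceedances (\<lambda>i. Z i \<omega>) n k. Z i \<omega> \<in> A)
    \<le> real k * \<P>(\<omega> in M. exceedances (\<lambda>i. Z i \<omega>) n k \<noteq> {} \<and>
          Z (sorted_list_of_set (exceedances (\<lambda>i. Z i \<omega>) n k) ! 0) \<omega> \<in> A)"
proof -
  let ?E = "\<lambda>\<omega>. exceedances (\<lambda>i. Z i \<omega>) n k"
  let ?first = "\<lambda>I. sorted_list_of_set I ! 0"
  define \<I> where "\<I> = {I. I \<subseteq> {..<n} \<and> I \<noteq> {} \<and> card I \<le> k}"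
  have fin: "finite \<I>" unfolding \<I>_def by (rule finite_subset[of _ "Pow {..<n}"]) auto
  have nonempty: "I \<noteq> {}" if "I \<in> \<I>" for I using that by (simp add: \<I>_def)
  have fin_I: "finite I" if "I \<in> \<I>" for I using that by (auto simp: \<I>_def intro: finite_subset)
  have first: "?first I \<in> I" if "I \<in> \<I>" for I
  proof -
    have "0 < length (sorted_list_of_set I)" using that fin_I[OF that] by (simp add: \<I>_def card_gt_0_iff)
    then have "?first I \<in> set (sorted_list_of_set I)" by (rule nth_mem)
    then show ?thesis using fin_I[OF that] by simp
  qed
  have E_meas [measurable]: "Measurable.pred samples (\<lambda>z. exceedances z n k = I)" for I
    by (rule measurable_from_count_space[where F = "\<lambda>E. E = I", OF measurable_exceedances[OF kn]]) simp
  have E_meas' [measurable]: "Measurable.pred M (\<lambda>\<omega>. ?E \<omega> = I)" for I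
    by (rule measurable_compose[OF sample_measurable E_meas])
  have E_in: "?E \<omega> \<in> \<I>" if "?E \<omega> \<noteq> {}" for \<omega>
    using that exceedances_subset card_exceedances_le[OF kn] by (auto simp: \<I>_def)
  have exch: "\<P>(\<omega> in M. ?E \<omega> = I \<and> Z i \<omega> \<in> A) = \<P>(\<omega> in M. ?E \<omega> = I \<and> Z (?first I) \<omega> \<in> A)"
    if I: "I \<in> \<I>" "i \<in> I" for I i
  proof -
    \<comment> \<open>Swapping \<open>i\<close> with the first index of \<open>I\<close> preserves
      the law of the sample and, both indices being in \<open>I\<close>, the event that
      \<open>I\<close> is the exceedance set; only the vector being tested changes.\<close>
    let ?\<pi> = "Transposition.transpose i (?first I)"
    have sub: "I \<subseteq> {..<n}" using I by (simp add: \<I>_def)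
    have "\<P>(\<omega> in M. exceedances (\<lambda>j. Z (?\<pi> j) \<omega>) n k = I \<and> Z (?\<pi> i) \<omega> \<in> A)
        = \<P>(\<omega> in M. ?E \<omega> = I \<and> Z i \<omega> \<in> A)"
      by (rule prob_reindex[where P = "\<lambda>z. exceedances z n k = I \<and> z i \<in> A"]) auto
    then show ?thesis
      using exceedances_transpose_eq_iff[OF kn sub I(2) first[OF I(1)], of "\<lambda>i. Z i _"] by simp
  qed
  have "{\<omega>\<in>space M. \<exists>i\<in>?E \<omega>. Z i \<omega> \<in> A} \<subseteq> (\<Union>I\<in>\<I>. \<Union>i\<in>I. {\<omega>\<in>space M. ?E \<omega> = I \<and> Z i \<omega> \<in> A})"
    using E_in by fastforce
  then have "\<P>(\<omega> in M. \<exists>i\<in>?E \<omega>. Z i \<omega> \<in> A)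
      \<le> prob (\<Union>I\<in>\<I>. \<Union>i\<in>I. {\<omega>\<in>space M. ?E \<omega> = I \<and> Z i \<omega> \<in> A})"
    using fin fin_I by (intro finite_measure_mono sets.finite_UN) auto
  also have "\<dots> \<le> (\<Sum>I\<in>\<I>. prob (\<Union>i\<in>I. {\<omega>\<in>space M. ?E \<omega> = I \<and> Z i \<omega> \<in> A}))"
    using fin fin_I by (intro measure_UNION_le) auto
  also have "\<dots> \<le> (\<Sum>I\<in>\<I>. \<Sum>i\<in>I. \<P>(\<omega> in M. ?E \<omega> = I \<and> Z i \<omega> \<in> A))"
    using fin_I by (intro sum_mono measure_UNION_le) auto
  also have "\<dots> = (\<Sum>I\<in>\<I>. real (card I) * \<P>(\<omega> in M. ?E \<omega> = I \<and> Z (?first I) \<omega> \<in> A))"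
    by (intro sum.cong) (auto simp: exch)
  \<comment> \<open>Here the factor \<open>k\<close> arises. The remaining events are disjoint for
    different \<open>I\<close>, so their probabilities add up to that of one event about the first
    exceedance.\<close>
  also have "\<dots> \<le> (\<Sum>I\<in>\<I>. real k * \<P>(\<omega> in M. ?E \<omega> = I \<and> Z (?first I) \<omega> \<in> A))"
    by (intro sum_mono mult_right_mono) (auto simp: \<I>_def)
  also have "\<dots> = real k * (\<Sum>I\<in>\<I>. \<P>(\<omega> in M. ?E \<omega> = I \<and> Z (?first I) \<omega> \<in> A))"
    by (simp add: sum_distrib_left)
  also have "(\<Sum>I\<in>\<I>. \<P>(\<omega> in M. ?E \<omega> = I \<and> Z (?first I) \<omega> \<in> A))
      = prob (\<Union>I\<in>\<I>. {\<omega>\<in>space M. ?E \<omega> = I \<and> Z (?first I) \<omega> \<in> A})"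
    using fin by (intro finite_measure_finite_Union[symmetric]) (auto simp: disjoint_family_on_def)
  also have "(\<Union>I\<in>\<I>. {\<omega>\<in>space M. ?E \<omega> = I \<and> Z (?first I) \<omega> \<in> A})
      = {\<omega>\<in>space M. ?E \<omega> \<noteq> {} \<and> Z (?first (?E \<omega>)) \<omega> \<in> A}"
    using E_in nonempty by blast
  finally show ?thesis .
qed

end

section \<open>Convergence of the support estimator\<close>

lemma angular_support_properties:
  fixes T :: "real ^ 'n \<Rightarrow> real ^ 'd"
  assumes T: "simplex_mapping T" and S: "prob_space S" "sets S = sets borel"
  shows "closed (msupp (angular_image T S))" "msupp (angular_image T S) \<noteq> {}"
    "msupp (angular_image T S) \<subseteq> unit_cube"
proof -
  have meas: "on_simplex T \<in> measurable S borel"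
    using borel_measurable_on_simplex[OF T] by (simp add: S(2) cong: measurable_cong_sets)
  interpret prob_space "angular_image T S"
    unfolding angular_image_def by (rule prob_space.prob_space_distr[OF S(1) meas])
  have cube: "unit_cube \<in> sets (borel :: (real ^ 'd) measure)"
    by (rule borel_closed[OF closed_unit_cube])
  \<comment> \<open>The default value 0 is in the cube too, so the masked map never leaves
    it.\<close>
  have null: "emeasure (angular_image T S) (- unit_cube) = 0"
    unfolding angular_image_def using cube on_simplex_in_unit_cube[OF T]
    by (subst emeasure_distr[OF meas]) (auto simp: vimage_def)
  show "closed (msupp (angular_image T S))" by (rule closed_msupp)
  show "msupp (angular_image T S) \<subseteq> unit_cube"
    by (rule msupp_subset_closed[OF closed_unit_cube null])
  have "emeasure (angular_image T S) unit_cube \<noteq> 0"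
  proof
    assume "emeasure (angular_image T S) unit_cube = 0"
    then have "emeasure (angular_image T S) (unit_cube \<union> - unit_cube) = 0"
      using null cube by (intro emeasure_Un_null_set[THEN trans])
        (auto simp: angular_image_def intro!: null_setsI)
    then show False using emeasure_space_1 by (simp add: angular_image_def)
  qed
  then show "msupp (angular_image T S) \<noteq> {}"
    by (intro msupp_nonempty[OF _ compact_unit_cube]) (simp add: angular_image_def)
qed

text \<open>Measurability is asked only for large \<open>n\<close>, since it is derived from
  \<open>k n < n\<close>, which holds only eventually.\<close>

lemma (in prob_space) prob_tendsto_1I:
  assumes meas: "\<forall>\<^sub>F n in sequentially. Measurable.pred M (P n)"
    and lim: "(\<lambda>n. \<P>(\<omega> in M. \<not> P n \<omega>)) \<longlonglongrightarrow> 0"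
  shows "(\<lambda>n. \<P>(\<omega> in M. P n \<omega>)) \<longlonglongrightarrow> 1"
proof -
  have "(\<lambda>n. 1 - \<P>(\<omega> in M. \<not> P n \<omega>)) \<longlonglongrightarrow> 1 - 0"
    by (intro tendsto_intros lim)
  moreover from meas have "\<forall>\<^sub>F n in sequentially. 1 - \<P>(\<omega> in M. \<not> P n \<omega>) = \<P>(\<omega> in M. P n \<omega>)"
  proof eventually_elim
    case (elim n)
    then show ?case by (subst prob_neg) (auto simp: pred_def)
  qed
  ultimately show ?thesis by (auto intro: Lim_transform_eventually)
qed

lemma exp_half_power_tendsto_0:
  assumes k: "filterlim k at_top sequentially" and "0 < q"
  shows "(\<lambda>n. exp (real (k n) / 2) / 2 ^ k n + exp (- (q * real (k n)))) \<longlonglongrightarrow> 0"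
proof -
  \<comment> \<open>The quadratic bound gives 7/4, below 2, so both terms are geometric sequences in
    \<open>k n\<close> with ratio below 1.\<close>
  have "exp (1 / 2 :: real) \<le> 1 + 1 / 2 + (1 / 2)\<^sup>2" by (rule exp_bound) auto
  then have "exp (1 / 2 :: real) / 2 < 1" by (simp add: power2_eq_square)
  then have "(\<lambda>j. (exp (1 / 2 :: real) / 2) ^ j + exp (- q) ^ j) \<longlonglongrightarrow> 0 + 0"
    using \<open>0 < q\<close> by (intro tendsto_add LIMSEQ_realpow_zero) auto
  from filterlim_compose[OF this k]
  have "(\<lambda>n. (exp (1 / 2) / 2) ^ k n + exp (- q) ^ k n) \<longlonglongrightarrow> (0::real)" by simp
  then show ?thesis
    by (simp add: power_divide exp_of_nat_mult[symmetric] mult.commute)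
qed

theorem theorem2p1:
  fixes M :: "'w measure"
    and Z :: "nat \<Rightarrow> 'w \<Rightarrow> real ^ 'n"
    and S :: "(real ^ 'n) measure"
    and T :: "real ^ 'n \<Rightarrow> real ^ 'd"
    and k m :: "nat \<Rightarrow> nat"
    and K :: "(real ^ 'd) set"
    and TS :: "nat \<Rightarrow> 'w \<Rightarrow> (real ^ 'd) set"
  assumes dim: "CARD('n) \<ge> 2" "CARD('d) = CARD('n) - 1"
    and T: "simplex_mapping T"
    and M: "prob_space M"
    and indep: "prob_space.indep_vars M (\<lambda>_. borel) Z UNIV"
    and ident: "\<And>i. distr M borel (Z i) = distr M borel (Z 0)"
    and nonneg: "AE \<omega> in M. Z 0 \<omega> \<in> nonneg_orthant"
    and mrv: "mrv_angular M (Z 0) S"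
    and K_def: "K = msupp (angular_image T S)"
    and i: "\<And>j x. j \<ge> 2 \<Longrightarrow> x \<in> grid j \<Longrightarrow>
              K \<inter> closure (cell x j) \<noteq> {} \<Longrightarrow> K \<inter> interior (cell x j) \<noteq> {}"
    and ii: "\<And>\<eta>. \<eta> > 0 \<Longrightarrow>
              (\<lambda>n. real (k n) *
                 \<P>(\<omega> in M. exceedances (\<lambda>i. Z i \<omega>) n (k n) \<noteq> {} \<and>
                           infdist (emp_point T (\<lambda>i. Z i \<omega>) n (k n) 0) K > \<eta>)) \<longlonglongrightarrow> 0"
    and k: "filterlim k at_top sequentially" "(\<lambda>n. real (k n) / real n) \<longlonglongrightarrow> 0"
    and m: "filterlim m at_top sequentially"
    and TS_def: "TS = (\<lambda>n \<omega>. tsupp_hat T (\<lambda>i. Z i \<omega>) n (k n) (m n))"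
  shows "(\<forall>n. \<forall>\<omega>\<in>space M. rast (msupp (emp_angular T (\<lambda>i. Z i \<omega>) n (k n))) (m n) = TS n \<omega>)
       \<and> conv_in_distribution M TS (\<lambda>_. K)
       \<and> (\<forall>\<epsilon>>0. (\<lambda>n. \<P>(\<omega> in M. hausdorff_dist (TS n \<omega>) K > ennreal \<epsilon>)) \<longlonglongrightarrow> 0)
       \<and> (\<forall>\<delta>>0. (\<lambda>n. \<P>(\<omega> in M. TS n \<omega> \<subseteq> delta_nbhd K \<delta>)) \<longlonglongrightarrow> 1
              \<and> (\<lambda>n. \<P>(\<omega> in M. K \<subseteq> delta_nbhd (TS n \<omega>) \<delta>)) \<longlonglongrightarrow> 1)"
proof -
  interpret prob_space M by fact
  interpret iid_vectors M Z by unfold_locales (fact indep ident)+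
  have S: "prob_space S" "sets S = sets borel" using mrv by (auto simp: mrv_angular_def)
  note K = angular_support_properties[OF T S, folded K_def]
  have K_cube: "K \<in> cube_compacts"
    using closed_Int_compact[OF K(1) compact_unit_cube] K(3)
    by (simp add: cube_compacts_def Int_absorb2)
  note ang_meas [measurable] = borel_measurable_mapped_angle[OF T]

  have k_pos: "\<forall>\<^sub>F n in sequentially. 0 < k n" and m_pos: "\<forall>\<^sub>F n in sequentially. 0 < m n"
    using eventually_compose_filterlim[OF eventually_gt_at_top k(1)]
      eventually_compose_filterlim[OF eventually_gt_at_top m] by auto
  have k_less: "\<forall>\<^sub>F n in sequentially. k n < n"
  proof -
    have "\<forall>\<^sub>F n in sequentially. real (k n) / real n < 1"
      using k(2) by (rule order_tendstoD) simp
    \<comment> \<open>At \<open>n = 0\<close> the quotient is 0 by convention and says nothing about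
      \<open>k n\<close>.\<close>
    then show ?thesis using eventually_gt_at_top[of 0]
      by eventually_elim (simp add: divide_less_eq)
  qed
  have TS_meas: "\<forall>\<^sub>F n in sequentially. TS n \<in> measurable M (count_space UNIV)"
    using k_less
  proof eventually_elim
    case (elim n)
    show ?case
      unfolding TS_def by (rule measurable_compose[OF sample_measurable measurable_tsupp_hat[OF T elim]])
  qed
  have TS_pred: "\<forall>\<^sub>F n in sequentially. Measurable.pred M (\<lambda>\<omega>. Q (TS n \<omega>))" for Q
    using TS_meas by eventually_elim (rule measurable_from_count_space[where F = Q], auto)

  \<comment> \<open>Outer inclusion\<close>
  have outer0: "(\<lambda>n. \<P>(\<omega> in M. \<not> TS n \<omega> \<subseteq> delta_nbhd K \<delta>)) \<longlonglongrightarrow> 0" if \<delta>: "0 < \<delta>" for \<delta>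
  proof (rule tendsto_sandwich[OF _ _ tendsto_const])
    let ?A = "{x. \<delta> / 2 < infdist (mapped_angle T x) K}"
    have [measurable]: "(\<lambda>x. infdist x K) \<in> borel_measurable borel"
      by (intro borel_measurable_continuous_onI continuous_intros)
    have A [measurable]: "?A \<in> sets borel"
      by measurable
    show "(\<lambda>n. real (k n) * \<P>(\<omega> in M. exceedances (\<lambda>i. Z i \<omega>) n (k n) \<noteq> {} \<and>
        \<delta> / 2 < infdist (emp_point T (\<lambda>i. Z i \<omega>) n (k n) 0) K)) \<longlonglongrightarrow> 0"
      \<comment> \<open>Half of \<delta> goes to the distance of the angles from \<open>K\<close>,
        the other half to the cell diameter.\<close>
      using \<delta> by (intro ii) simp
    have "\<forall>\<^sub>F n in sequentially. real CARD('d) / (\<delta> / 2) < real (m n)"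
      using eventually_compose_filterlim[OF eventually_gt_at_top filterlim_compose[OF filterlim_real_sequentially m]] .
    then show "\<forall>\<^sub>F n in sequentially. \<P>(\<omega> in M. \<not> TS n \<omega> \<subseteq> delta_nbhd K \<delta>) \<le>
      real (k n) * \<P>(\<omega> in M. exceedances (\<lambda>i. Z i \<omega>) n (k n) \<noteq> {} \<and>
        \<delta> / 2 < infdist (emp_point T (\<lambda>i. Z i \<omega>) n (k n) 0) K)"
      using k_less m_pos
    proof eventually_elim
      case (elim n)
      have "real CARD('d) / real (m n) < \<delta> / 2" using elim(1,3) \<delta> by (simp add: field_simps)
      then have \<delta>': "\<delta> / 2 + real CARD('d) / real (m n) < \<delta>" by linarith
      have "\<exists>i\<in>exceedances (\<lambda>i. Z i \<omega>) n (k n). \<delta> / 2 < infdist (mapped_angle T (Z i \<omega>)) K"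
        if "\<not> TS n \<omega> \<subseteq> delta_nbhd K \<delta>" for \<omega>
        using that tsupp_hat_subset_delta_nbhd[OF K(1,2) _ \<delta>', of "\<lambda>i. Z i \<omega>" n "k n" T]
        unfolding TS_def by (meson not_less)
      then have sub: "{\<omega>\<in>space M. \<not> TS n \<omega> \<subseteq> delta_nbhd K \<delta>} \<subseteq>
          {\<omega>\<in>space M. \<exists>i\<in>exceedances (\<lambda>i. Z i \<omega>) n (k n). Z i \<omega> \<in> ?A}"
        by auto
      have "\<P>(\<omega> in M. \<not> TS n \<omega> \<subseteq> delta_nbhd K \<delta>)
          \<le> \<P>(\<omega> in M. \<exists>i\<in>exceedances (\<lambda>i. Z i \<omega>) n (k n). Z i \<omega> \<in> ?A)"
        by (intro finite_measure_mono[OF sub] sets_some_exceedance_in A elim)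
      also note prob_some_exceedance_in_le[OF A elim(2)]
      finally show ?case by (simp add: emp_point_def)
    qed
  qed (auto intro!: always_eventually)

  \<comment> \<open>Exceedances with angle in an open set of positive mass\<close>
  obtain u where u: "\<forall>\<^sub>F t in at_top. t * \<P>(\<omega> in M. u t < l1norm (Z 0 \<omega>)) \<le> 1 / 2"
    and hit_level: "\<And>V. open V \<Longrightarrow> 0 \<notin> V \<Longrightarrow> 0 < emeasure (angular_image T S) V \<Longrightarrow>
       \<exists>q>0. \<forall>\<^sub>F t in at_top. q \<le> t * \<P>(\<omega> in M. u t < l1norm (Z 0 \<omega>) \<and> mapped_angle T (Z 0 \<omega>) \<in> V)"
    by (rule mrv_exceedance_levels[OF Z_measurable nonneg mrv T]) (rule that)

  have hit0: "(\<lambda>n. \<P>(\<omega> in M. \<not> (\<exists>i\<in>exceedances (\<lambda>i. Z i \<omega>) n (k n). mapped_angle T (Z i \<omega>) \<in> V))) \<longlonglongrightarrow> 0"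
    if V: "open V" "0 \<notin> V" "0 < emeasure (angular_image T S) V" for V
  proof -
    from hit_level[OF V] obtain q where q: "0 < q"
      "\<forall>\<^sub>F t in at_top. q \<le> t * \<P>(\<omega> in M. u t < l1norm (Z 0 \<omega>) \<and> mapped_angle T (Z 0 \<omega>) \<in> V)"
      by blast
    have [measurable]: "V \<in> sets borel" using V(1) by simp
    \<comment> \<open>With \<open>t = n / k\<close> the two estimates
      \<open>t * p \<le> 1 / 2\<close> and \<open>q \<le> t * p\<close> become
      \<open>n * p \<le> k / 2\<close> and \<open>q * k \<le> n * p\<close>, the exponents of the
      two error terms.\<close>
    define t where "t n = real n / real (k n)" for n
    have t: "filterlim t at_top sequentially"
    proof -
      have "\<forall>\<^sub>F n in sequentially. 0 < real (k n) / real n"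
        using k_pos k_less by eventually_elim auto
      from filterlim_inverse_at_top[OF k(2) this] show ?thesis by (simp add: t_def[abs_def])
    qed
    show ?thesis
    proof (rule tendsto_sandwich[OF _ _ tendsto_const exp_half_power_tendsto_0[OF k(1) q(1)]])
      show "\<forall>\<^sub>F n in sequentially.
          \<P>(\<omega> in M. \<not> (\<exists>i\<in>exceedances (\<lambda>i. Z i \<omega>) n (k n). mapped_angle T (Z i \<omega>) \<in> V))
          \<le> exp (real (k n) / 2) / 2 ^ k n + exp (- (q * real (k n)))"
        using eventually_compose_filterlim[OF u t] eventually_compose_filterlim[OF q(2) t] k_pos k_less
      proof eventually_elim
        case (elim n)
        let ?A = "{x. u (t n) < l1norm x \<and> mapped_angle T x \<in> V}"
        have A: "?A \<in> sets borel" by measurable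
        have "\<P>(\<omega> in M. \<not> (\<exists>i\<in>exceedances (\<lambda>i. Z i \<omega>) n (k n). mapped_angle T (Z i \<omega>) \<in> V))
          \<le> \<P>(\<omega> in M. \<not> (\<exists>i\<in>exceedances (\<lambda>i. Z i \<omega>) n (k n). Z i \<omega> \<in> ?A))"
          by (intro finite_measure_mono sets.sets_Collect_neg sets_some_exceedance_in A elim) auto
        also have "\<dots> \<le> exp (real n * \<P>(\<omega> in M. u (t n) < l1norm (Z 0 \<omega>))) / 2 ^ k n
            + exp (- (real n * \<P>(\<omega> in M. Z 0 \<omega> \<in> ?A)))"
          by (rule prob_no_exceedance_in_le[OF A elim(4)]) simp
        also have "\<dots> \<le> exp (real (k n) / 2) / 2 ^ k n + exp (- (q * real (k n)))"
        proof (intro add_mono divide_right_mono)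
          show "exp (real n * \<P>(\<omega> in M. u (t n) < l1norm (Z 0 \<omega>))) \<le> exp (real (k n) / 2)"
            using elim(1,3) by (simp add: t_def field_simps)
          show "exp (- (real n * \<P>(\<omega> in M. Z 0 \<omega> \<in> ?A))) \<le> exp (- (q * real (k n)))"
            using elim(2,3) by (simp add: t_def field_simps)
        qed simp
        finally show ?case .
      qed
    qed (auto intro!: always_eventually)
  qed

  \<comment> \<open>Inner inclusion\<close>
  have inner0: "(\<lambda>n. \<P>(\<omega> in M. \<not> K \<subseteq> delta_nbhd (TS n \<omega>) \<delta>)) \<longlonglongrightarrow> 0" if \<delta>: "0 < \<delta>" for \<delta>
  proof -
    \<comment> \<open>No cell of \<open>grid m\<close> contains a point with a coordinate \<open>1\<close>. Assumption \<open>i\<close>, at one fixed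
      resolution \<open>l\<close>, replaces each point of \<open>K\<close> by a nearby open set that the cells cover and to
      which \<open>S\<close> gives positive mass.\<close>
    obtain l0 :: nat where l0: "real CARD('d) / \<delta> < real l0" using reals_Archimedean2 by blast
    define l where "l = max 2 l0"
    have l: "2 \<le> l" "real CARD('d) / real l < \<delta>"
    proof -
      have "real CARD('d) / \<delta> < real l" using l0 by (simp add: l_def)
      then show "real CARD('d) / real l < \<delta>" using \<delta> by (simp add: l_def field_simps)
    qed (simp add: l_def)
    define \<G> where "\<G> = {g \<in> grid l. K \<inter> closure (cell g l) \<noteq> {}}"
    have fin: "finite \<G>" by (simp add: \<G>_def finite_grid)
    let ?miss = "\<lambda>n g \<omega>. \<not> (\<exists>i\<in>exceedances (\<lambda>i. Z i \<omega>) n (k n). mapped_angle T (Z i \<omega>) \<in> interior (cell g l))"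
    have "(\<lambda>n. \<Sum>g\<in>\<G>. \<P>(\<omega> in M. ?miss n g \<omega>)) \<longlonglongrightarrow> (\<Sum>g\<in>\<G>. 0)"
    proof (intro tendsto_sum hit0)
      fix g assume g: "g \<in> \<G>"
      then have "K \<inter> interior (cell g l) \<noteq> {}" using i[OF l(1)] by (simp add: \<G>_def)
      then show "0 < emeasure (angular_image T S) (interior (cell g l))"
        by (auto simp: K_def msupp_def)
      show "0 \<notin> interior (cell g l)" using g zero_notin_interior_cell by (auto simp: \<G>_def)
    qed simp
    then have lim: "(\<lambda>n. \<Sum>g\<in>\<G>. \<P>(\<omega> in M. ?miss n g \<omega>)) \<longlonglongrightarrow> 0" by simp
    show ?thesis
    proof (rule tendsto_sandwich[OF _ _ tendsto_const lim])
      show "\<forall>\<^sub>F n in sequentially. \<P>(\<omega> in M. \<not> K \<subseteq> delta_nbhd (TS n \<omega>) \<delta>)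
          \<le> (\<Sum>g\<in>\<G>. \<P>(\<omega> in M. ?miss n g \<omega>))"
        using k_pos m_pos k_less
      proof eventually_elim
        case (elim n)
        have meas: "{\<omega>\<in>space M. ?miss n g \<omega>} \<in> sets M" for g
        proof -
          have [measurable]: "interior (cell g l) \<in> sets borel" by simp
          have A: "{x. mapped_angle T x \<in> interior (cell g l)} \<in> sets borel"
            by measurable
          show ?thesis
            using sets.sets_Collect_neg[OF sets_some_exceedance_in[OF A elim(3)]] by simp
        qed
        have "{\<omega>\<in>space M. \<not> K \<subseteq> delta_nbhd (TS n \<omega>) \<delta>} \<subseteq> (\<Union>g\<in>\<G>. {\<omega>\<in>space M. ?miss n g \<omega>})"
        proof (rule subsetI, rule ccontr)
          fix \<omega> assume \<omega>: "\<omega> \<in> {\<omega>\<in>space M. \<not> K \<subseteq> delta_nbhd (TS n \<omega>) \<delta>}"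
            "\<omega> \<notin> (\<Union>g\<in>\<G>. {\<omega>\<in>space M. ?miss n g \<omega>})"
          have "K \<subseteq> delta_nbhd (TS n \<omega>) \<delta>"
            unfolding TS_def
          proof (rule subset_delta_nbhd_tsupp_hat[where l = l])
            fix g assume "g \<in> grid l" "K \<inter> closure (cell g l) \<noteq> {}"
            then have "\<not> ?miss n g \<omega>" using \<omega> by (auto simp: \<G>_def)
            then show "\<exists>i\<in>exceedances (\<lambda>i. Z i \<omega>) n (k n). mapped_angle T (Z i \<omega>) \<in> cell g l"
              using interior_subset by blast
          qed (use K(3) l elim in auto)
          with \<omega> show False by simp
        qed
        then have "\<P>(\<omega> in M. \<not> K \<subseteq> delta_nbhd (TS n \<omega>) \<delta>) \<le> prob (\<Union>g\<in>\<G>. {\<omega>\<in>space M. ?miss n g \<omega>})"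
          using fin meas by (intro finite_measure_mono sets.finite_UN) auto
        also have "\<dots> \<le> (\<Sum>g\<in>\<G>. \<P>(\<omega> in M. ?miss n g \<omega>))"
          using fin meas by (intro measure_UNION_le) auto
        finally show ?case .
      qed
    qed (auto intro!: always_eventually)
  qed

  \<comment> \<open>Convergence in probability in the Hausdorff distance\<close>
  have far0: "(\<lambda>n. \<P>(\<omega> in M. hausdorff_dist (TS n \<omega>) K > ennreal \<epsilon>)) \<longlonglongrightarrow> 0" if \<epsilon>: "0 < \<epsilon>" for \<epsilon>
  proof (rule tendsto_sandwich[OF _ _ tendsto_const])
    show "(\<lambda>n. \<P>(\<omega> in M. \<not> TS n \<omega> \<subseteq> delta_nbhd K \<epsilon>) + \<P>(\<omega> in M. \<not> K \<subseteq> delta_nbhd (TS n \<omega>) \<epsilon>)) \<longlonglongrightarrow> 0"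
      using tendsto_add[OF outer0[OF \<epsilon>] inner0[OF \<epsilon>]] by simp
    show "\<forall>\<^sub>F n in sequentially. \<P>(\<omega> in M. hausdorff_dist (TS n \<omega>) K > ennreal \<epsilon>)
        \<le> \<P>(\<omega> in M. \<not> TS n \<omega> \<subseteq> delta_nbhd K \<epsilon>) + \<P>(\<omega> in M. \<not> K \<subseteq> delta_nbhd (TS n \<omega>) \<epsilon>)"
      using TS_pred[of "\<lambda>A. \<not> A \<subseteq> delta_nbhd K \<epsilon>"] TS_pred[of "\<lambda>A. \<not> K \<subseteq> delta_nbhd A \<epsilon>"]
    proof eventually_elim
      case (elim n)
      have "{\<omega>\<in>space M. hausdorff_dist (TS n \<omega>) K > ennreal \<epsilon>} \<subseteq>
          {\<omega>\<in>space M. \<not> TS n \<omega> \<subseteq> delta_nbhd K \<epsilon>} \<union> {\<omega>\<in>space M. \<not> K \<subseteq> delta_nbhd (TS n \<omega>) \<epsilon>}"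
        using hausdorff_dist_le[OF \<epsilon>] by (blast dest: leD)
      then have "\<P>(\<omega> in M. hausdorff_dist (TS n \<omega>) K > ennreal \<epsilon>) \<le>
          prob ({\<omega>\<in>space M. \<not> TS n \<omega> \<subseteq> delta_nbhd K \<epsilon>} \<union> {\<omega>\<in>space M. \<not> K \<subseteq> delta_nbhd (TS n \<omega>) \<epsilon>})"
        using elim by (intro finite_measure_mono sets.Un) (auto simp: pred_def)
      also have "\<dots> \<le> \<P>(\<omega> in M. \<not> TS n \<omega> \<subseteq> delta_nbhd K \<epsilon>) + \<P>(\<omega> in M. \<not> K \<subseteq> delta_nbhd (TS n \<omega>) \<epsilon>)"
        using elim by (intro measure_Un_le) (auto simp: pred_def)
      finally show ?case .
    qed
  qed (auto intro!: always_eventually)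

  \<comment> \<open>Convergence in distribution to a constant limit\<close>
  have TS_cube: "TS n \<omega> \<in> cube_compacts" for n \<omega>
    unfolding TS_def by (rule tsupp_hat_cube_compacts)
  have "conv_in_distribution M TS (\<lambda>_. K)"
    unfolding conv_in_distribution_def
  proof (intro conjI allI impI ballI TS_cube K_cube)
    fix F :: "(real ^ 'd) set \<Rightarrow> real"
    assume "(\<exists>c. \<forall>A\<in>cube_compacts. \<bar>F A\<bar> \<le> c) \<and>
        (\<forall>A\<in>cube_compacts. \<forall>\<epsilon>>0. \<exists>\<delta>>0. \<forall>B\<in>cube_compacts.
            hausdorff_dist A B < ennreal \<delta> \<longrightarrow> \<bar>F B - F A\<bar> < \<epsilon>)"
    then obtain c where c: "\<And>A. A \<in> cube_compacts \<Longrightarrow> \<bar>F A\<bar> \<le> c"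
      and cont: "\<And>\<epsilon>. 0 < \<epsilon> \<Longrightarrow> \<exists>\<delta>>0. \<forall>B\<in>cube_compacts. hausdorff_dist K B < ennreal \<delta> \<longrightarrow> \<bar>F B - F K\<bar> < \<epsilon>"
      using K_cube by blast
    have c0: "0 \<le> c" using c[OF K_cube] by linarith
    have "(\<lambda>n. \<integral>\<omega>. F (TS n \<omega>) \<partial>M) \<longlonglongrightarrow> F K"
    proof (rule tendstoI)
      fix \<epsilon> :: real assume "0 < \<epsilon>"
      then obtain \<delta> where \<delta>: "0 < \<delta>"
        "\<And>B. B \<in> cube_compacts \<Longrightarrow> hausdorff_dist K B < ennreal \<delta> \<Longrightarrow> \<bar>F B - F K\<bar> < \<epsilon> / 2"
        using cont[of "\<epsilon> / 2"] by auto
      \<comment> \<open>Off this event the distance is only known to be at most the threshold, while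
        continuity of \<open>F\<close> at \<open>K\<close> asks for strictly less than \<delta>;
        hence \<open>\<delta> / 2\<close>.\<close>
      let ?far = "\<lambda>n. {\<omega>\<in>space M. hausdorff_dist (TS n \<omega>) K > ennreal (\<delta> / 2)}"
      have "(\<lambda>n. \<epsilon> / 2 + 2 * c * prob (?far n)) \<longlonglongrightarrow> \<epsilon> / 2 + 2 * c * 0"
        using \<delta>(1) by (intro tendsto_intros far0) simp
      then have "\<forall>\<^sub>F n in sequentially. \<epsilon> / 2 + 2 * c * prob (?far n) < \<epsilon>"
        by (rule order_tendstoD(2)) (use \<open>0 < \<epsilon>\<close> in simp)
      then show "\<forall>\<^sub>F n in sequentially. dist (\<integral>\<omega>. F (TS n \<omega>) \<partial>M) (F K) < \<epsilon>"
        using TS_meas TS_pred[of "\<lambda>A. hausdorff_dist A K > ennreal (\<delta> / 2)"]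
      proof eventually_elim
        case (elim n)
        have [measurable]: "(\<lambda>\<omega>. F (TS n \<omega>)) \<in> borel_measurable M"
          by (rule measurable_from_count_space[OF elim(2)]) simp
        have far_meas [measurable]: "?far n \<in> sets M" using elim(3) by (simp add: pred_def)
        have int: "integrable M (\<lambda>\<omega>. F (TS n \<omega>))"
          using c[OF TS_cube] by (intro integrable_const_bound[of _ c]) auto
        \<comment> \<open>Continuity at \<open>K\<close> controls the difference off the far event,
          and boundedness by \<open>c\<close> controls it on that event, whose probability tends to
          0.\<close>
        have bound: "\<bar>F (TS n \<omega>) - F K\<bar> \<le> \<epsilon> / 2 + 2 * c * indicator (?far n) \<omega>" if "\<omega> \<in> space M" for \<omega>
        proof (cases "\<omega> \<in> ?far n")
          case True
          have "\<bar>F (TS n \<omega>) - F K\<bar> \<le> 2 * c"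
            using c[OF TS_cube, of n \<omega>] c[OF K_cube] by linarith
          then show ?thesis using True \<open>0 < \<epsilon>\<close> by simp
        next
          case False
          then have "hausdorff_dist K (TS n \<omega>) \<le> ennreal (\<delta> / 2)"
            using that by (simp add: hausdorff_dist_commute not_less)
          also have "\<dots> < ennreal \<delta>" using \<delta>(1) by (intro ennreal_lessI) auto
          finally have "\<bar>F (TS n \<omega>) - F K\<bar> < \<epsilon> / 2" by (rule \<delta>(2)[OF TS_cube])
          with False show ?thesis by simp
        qed
        have "\<bar>(\<integral>\<omega>. F (TS n \<omega>) \<partial>M) - F K\<bar> = \<bar>\<integral>\<omega>. F (TS n \<omega>) - F K \<partial>M\<bar>"
          using int by (simp add: prob_space)
        also have "\<dots> \<le> (\<integral>\<omega>. \<bar>F (TS n \<omega>) - F K\<bar> \<partial>M)"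
          by (rule integral_abs_bound)
        also have "\<dots> \<le> (\<integral>\<omega>. \<epsilon> / 2 + 2 * c * indicator (?far n) \<omega> \<partial>M)"
          using int bound by (intro integral_mono integrable_abs Bochner_Integration.integrable_diff
              Bochner_Integration.integrable_add integrable_mult_right integrable_real_indicator)
             (auto simp: less_top[symmetric])
        also have "\<dots> = \<epsilon> / 2 + 2 * c * prob (?far n)"
          by (subst Bochner_Integration.integral_add)
             (auto intro!: integrable_mult_right integrable_real_indicator simp: less_top[symmetric] prob_space)
        finally show ?case using elim(1) by (simp add: dist_real_def)
      qed
    qed
    then show "(\<lambda>n. \<integral>\<omega>. F (TS n \<omega>) \<partial>M) \<longlonglongrightarrow> (\<integral>\<omega>. F K \<partial>M)"
      by (simp add: prob_space)
  qed
  moreover have "(\<lambda>n. \<P>(\<omega> in M. TS n \<omega> \<subseteq> delta_nbhd K \<delta>)) \<longlonglongrightarrow> 1"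
    "(\<lambda>n. \<P>(\<omega> in M. K \<subseteq> delta_nbhd (TS n \<omega>) \<delta>)) \<longlonglongrightarrow> 1" if "0 < \<delta>" for \<delta>
    by (rule prob_tendsto_1I[OF TS_pred outer0[OF that]])
       (rule prob_tendsto_1I[OF TS_pred inner0[OF that]])
  ultimately show ?thesis
    using far0 by (simp add: TS_def rast_msupp_emp_angular)
qed

end
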